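(* For every $g\in\mathfrak F_m$ and all $f_1,f_2\in\mathcal A_{(n,m)}$, the functions $f_j\circ\mathrm L(g)$ belong to $\mathcal A_{(n,m)}$ and $$\big(f_1\circ\mathrm L(g)\big)\ast_{(n,m)}\big(f_2\circ\mathrm L(g)\big)=(f_1\ast_{(n,m)}f_2)\circ\mathrm L(g).$$
   Context: Throughout, $(n,m)$ is one of $(2,2),(3,4),(5,8)$ and $\hbar>0$ is a parameter. For $\mathbf z,\mathbf w\in\mathbb C^k$ write $\mathbf z\cdot\mathbf w=\sum_{s=1}^k z_s\overline{w_s}$ and $|\mathbf z|^2=\mathbf z\cdot\mathbf z$. The map $\rho_{(n,m)}=(\rho_1,\dots,\rho_{n+1}):\mathbb C^m\to\mathbb C^{n+1}$ is defined by: for $(2,2)$: $\rho_1=\tfrac12(z_2^2-z_1^2)$, $\rho_2=\tfrac{i}{2}(z_1^2+z_2^2)$, $\rho_3=z_1z_2$; for $(3,4)$: $\rho_1=z_1z_3+z_2z_4$, $\rho_2=i(z_1z_3-z_2z_4)$, $\rho_3=i(z_1z_4+z_2z_3)$, $\rho_4=z_1z_4-z_2z_3$; for $(5,8)$: $\rho_1=i(-z_1z_6+z_3z_8+z_2z_5-z_4z_7)$, $\rho_2=z_1z_6+z_3z_8+z_2z_5+z_4z_7$, $\rho_3=z_2z_6+z_3z_7-z_1z_5-z_4z_8$, $\rho_4=i(-z_1z_5+z_4z_8-z_2z_6+z_3z_7)$, $\rho_5=i(-z_1z_8-z_2z_7-z_3z_6-z_4z_5)$, $\rho_6=z_1z_8+z_2z_7-z_3z_6-z_4z_5$.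 $S^n\subset\mathbb R^{n+1}$ is the unit sphere with normalized surface measure $d\Omega$ and $\langle\phi,\psi\rangle_{S^n}=\int_{S^n}\phi\overline\psi\,d\Omega$. For $\boldsymbol\alpha\in\mathbb C^{n+1}$ the coherent state is $\Phi^{(\hbar)}_{\boldsymbol\alpha}(\mathbf x)=\sum_{\ell\ge0}\frac{\sqrt{2\ell+n-1}}{\ell!\sqrt{n-1}}\big(\frac{\mathbf x\cdot\boldsymbol\alpha}{\hbar}\big)^\ell$, $\mathbf x\in S^n$. The measure on $\mathbb C^m$ is $d\mu_m(\mathbf z)=(\pi\hbar)^{-m}e^{-|\mathbf z|^2/\hbar}\,d\mathbf z\,d\overline{\mathbf z}$. The kernel is $\mathbf Q^{(\hbar)}_m(\mathbf z,\mathbf w)=\langle \Phi^{(\hbar)}_{\rho_{(n,m)}(\mathbf w)},\Phi^{(\hbar)}_{\rho_{(n,m)}(\mathbf z)}\rangle_{S^n}$. For a bounded operator $A$ on $L^2(S^n)$, its Berezin symbol is $\mathfrak B(A)(\mathbf z)=\frac{\langle A\Phi_{\rho(\mathbf z)},\Phi_{\rho(\mathbf z)}\rangle_{S^n}}{\langle \Phi_{\rho(\mathbf z)},\Phi_{\rho(\mathbf z)}\rangle_{S^n}}$ and its extended Berezin symbol is $\mathfrak B(A)(\mathbf w,\mathbf z)=\frac{\langle A\Phi_{\rho(\mathbf z)},\Phi_{\rho(\mathbf w)}\rangle_{S^n}}{\langle \Phi_{\rho(\mathbf z)},\Phi_{\rho(\mathbf w)}\rangle_{S^n}}$ (with $\Phi_{\rho(\mathbf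 z)}=\Phi^{(\hbar)}_{\rho_{(n,m)}(\mathbf z)}$), defined where the denominator is nonzero. $\mathcal A_{(n,m)}=\{\mathfrak B(A): A\in\mathbf B(L^2(S^n))\}$. For $f_1,f_2\in\mathcal A_{(n,m)}$ with extended symbols $f_j(\cdot,\cdot)$, the star product is $(f_1\ast_{(n,m)}f_2)(\mathbf z)=\int_{\mathbb C^m}f_1(\mathbf z,\mathbf u)f_2(\mathbf u,\mathbf z)\frac{|\mathbf Q_m^{(\hbar)}(\mathbf u,\mathbf z)|^2}{\mathbf Q_m^{(\hbar)}(\mathbf z,\mathbf z)}\,d\mu_m(\mathbf u)$. The groups are $\mathfrak F_2=\mathrm{SU}(2)$, $\mathfrak F_4=\mathrm{SU}(2)\times\mathrm{SU}(2)$, $\mathfrak F_8=\mathrm{SU}(4)$, acting on $\mathbb C^m$ by $\mathbf z\mapsto\mathrm L(g)\mathbf z$ with: $\mathrm L(g)=g$ for $g\in\mathrm{SU}(2)$ ($m=2$); $\mathrm L(g)=\begin{pmatrix}V&0\\0&W\end{pmatrix}$ for $g=(V,W)$ ($m=4$); $\mathrm L(g)=\begin{pmatrix}U&0\\0&EUE\end{pmatrix}$ for $g=U\in\mathrm{SU}(4)$ ($m=8$), where $E=\begin{pmatrix}0&0&-1&0\\0&0&0&1\\-1&0&0&0\\0&1&0&0\end{pmatrix}$. *)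

theory Defs
  imports "HOL-Analysis.Analysis"
begin

text \<open>Vectors in C^k are represented as functions nat => complex, using coordinates
  0..k-1 (paper's coordinate z_s is index s-1); R^k likewise with nat => real.\<close>

type_synonym cvec = "nat \<Rightarrow> complex"
type_synonym rvec = "nat \<Rightarrow> real"
type_synonym cmat = "nat \<Rightarrow> nat \<Rightarrow> complex"

definition cdot :: "nat \<Rightarrow> cvec \<Rightarrow> cvec \<Rightarrow> complex" where
  "cdot k z w = (\<Sum>s<k. z s * cnj (w s))"

definition cnormsq :: "nat \<Rightarrow> cvec \<Rightarrow> real" where
  "cnormsq k z = (\<Sum>s<k. (cmod (z s))\<^sup>2)"

definition lebR :: "nat \<Rightarrow> rvec measure" where
  "lebR k = PiM {..<k} (\<lambda>_. lborel)"

definition lebC :: "nat \<Rightarrow> cvec measure" where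
  "lebC k = PiM {..<k} (\<lambda>_. lborel)"

definition unit_ball :: "nat \<Rightarrow> rvec set" where
  "unit_ball k = {x \<in> space (lebR k). (\<Sum>i<k. (x i)\<^sup>2) \<le> 1}"

definition radial_proj :: "nat \<Rightarrow> rvec \<Rightarrow> rvec" where
  "radial_proj k x = (\<lambda>i\<in>{..<k}. x i / sqrt (\<Sum>j<k. (x j)\<^sup>2))"

text \<open>Normalized surface measure on S^n \<subseteq> R^(n+1): the push-forward of the
  normalized Lebesgue measure of the unit ball under x |-> x/|x|.\<close>
definition sphere_measure :: "nat \<Rightarrow> rvec measure" where
  "sphere_measure n =
     distr (uniform_measure (lebR (Suc n)) (unit_ball (Suc n))) (lebR (Suc n)) (radial_proj (Suc n))"

definition sphere_inner :: "nat \<Rightarrow> (rvec \<Rightarrow> complex) \<Rightarrow> (rvec \<Rightarrow> complex) \<Rightarrow> complex" where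
  "sphere_inner n \<phi> \<psi> = integral\<^sup>L (sphere_measure n) (\<lambda>x. \<phi> x * cnj (\<psi> x))"

definition sq_int :: "nat \<Rightarrow> (rvec \<Rightarrow> complex) \<Rightarrow> bool" where
  "sq_int n \<phi> \<longleftrightarrow> \<phi> \<in> borel_measurable (sphere_measure n)
      \<and> integrable (sphere_measure n) (\<lambda>x. (cmod (\<phi> x))\<^sup>2)"

definition L2norm :: "nat \<Rightarrow> (rvec \<Rightarrow> complex) \<Rightarrow> real" where
  "L2norm n \<phi> = sqrt (integral\<^sup>L (sphere_measure n) (\<lambda>x. (cmod (\<phi> x))\<^sup>2))"

text \<open>A bounded (linear) operator on L^2(S^n), acting on representatives:
  it maps square-integrable functions to square-integrable functions, is linear
  up to null sets, and is bounded (hence respects equality almost everywhere).\<close>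
definition bounded_op :: "nat \<Rightarrow> ((rvec \<Rightarrow> complex) \<Rightarrow> (rvec \<Rightarrow> complex)) \<Rightarrow> bool" where
  "bounded_op n A \<longleftrightarrow>
     (\<forall>\<phi>. sq_int n \<phi> \<longrightarrow> sq_int n (A \<phi>))
   \<and> (\<forall>\<phi> \<psi> a b. sq_int n \<phi> \<longrightarrow> sq_int n \<psi> \<longrightarrow>
        (AE x in sphere_measure n. A (\<lambda>y. a * \<phi> y + b * \<psi> y) x = a * A \<phi> x + b * A \<psi> x))
   \<and> (\<exists>C. \<forall>\<phi>. sq_int n \<phi> \<longrightarrow> L2norm n (A \<phi>) \<le> C * L2norm n \<phi>)"

definition coh :: "nat \<Rightarrow> real \<Rightarrow> cvec \<Rightarrow> rvec \<Rightarrow> complex" where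
  "coh n hbar \<alpha> x =
     (\<Sum>l. complex_of_real (sqrt (2 * real l + real n - 1) / (fact l * sqrt (real n - 1)))
          * ((\<Sum>s<Suc n. complex_of_real (x s) * cnj (\<alpha> s)) / complex_of_real hbar) ^ l)"

text \<open>Paper's z_k is z (k-1); the result rho_k is stored at index k-1.\<close>
definition rho :: "nat \<Rightarrow> nat \<Rightarrow> cvec \<Rightarrow> cvec" where
  "rho n m z = (let Z = (\<lambda>k. z (k - 1)) in
     if (n, m) = (2, 2) then
       (\<lambda>i. if i = 0 then (Z 2 ^ 2 - Z 1 ^ 2) / 2
            else if i = 1 then \<i> / 2 * (Z 1 ^ 2 + Z 2 ^ 2)
            else if i = 2 then Z 1 * Z 2 else 0)
     else if (n, m) = (3, 4) then
       (\<lambda>i. if i = 0 then Z 1 * Z 3 + Z 2 * Z 4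
            else if i = 1 then \<i> * (Z 1 * Z 3 - Z 2 * Z 4)
            else if i = 2 then \<i> * (Z 1 * Z 4 + Z 2 * Z 3)
            else if i = 3 then Z 1 * Z 4 - Z 2 * Z 3 else 0)
     else if (n, m) = (5, 8) then
       (\<lambda>i. if i = 0 then \<i> * (- Z 1 * Z 6 + Z 3 * Z 8 + Z 2 * Z 5 - Z 4 * Z 7)
            else if i = 1 then Z 1 * Z 6 + Z 3 * Z 8 + Z 2 * Z 5 + Z 4 * Z 7
            else if i = 2 then Z 2 * Z 6 + Z 3 * Z 7 - Z 1 * Z 5 - Z 4 * Z 8
            else if i = 3 then \<i> * (- Z 1 * Z 5 + Z 4 * Z 8 - Z 2 * Z 6 + Z 3 * Z 7)
            else if i = 4 then \<i> * (- Z 1 * Z 8 - Z 2 * Z 7 - Z 3 * Z 6 - Z 4 * Z 5)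
            else if i = 5 then Z 1 * Z 8 + Z 2 * Z 7 - Z 3 * Z 6 - Z 4 * Z 5 else 0)
     else (\<lambda>_. 0))"

abbreviation Phi :: "nat \<Rightarrow> nat \<Rightarrow> real \<Rightarrow> cvec \<Rightarrow> rvec \<Rightarrow> complex" where
  "Phi n m hbar z \<equiv> coh n hbar (rho n m z)"

definition mu :: "nat \<Rightarrow> real \<Rightarrow> cvec measure" where
  "mu m hbar = density (lebC m)
     (\<lambda>z. ennreal ((pi * hbar) powi (- int m) * exp (- cnormsq m z / hbar)))"

definition Qker :: "nat \<Rightarrow> nat \<Rightarrow> real \<Rightarrow> cvec \<Rightarrow> cvec \<Rightarrow> complex" where
  "Qker n m hbar z w = sphere_inner n (Phi n m hbar w) (Phi n m hbar z)"

definition berezin :: "nat \<Rightarrow> nat \<Rightarrow> real \<Rightarrow> ((rvec \<Rightarrow> complex) \<Rightarrow> (rvec \<Rightarrow> complex)) \<Rightarrow> cvec \<Rightarrow> complex" where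
  "berezin n m hbar A z =
     sphere_inner n (A (Phi n m hbar z)) (Phi n m hbar z) / sphere_inner n (Phi n m hbar z) (Phi n m hbar z)"

text \<open>Extended Berezin symbol B(A)(w,z); where the denominator vanishes the value is 0
  (Isabelle's division convention); this only happens on a null set.\<close>
definition berezin_ext :: "nat \<Rightarrow> nat \<Rightarrow> real \<Rightarrow> ((rvec \<Rightarrow> complex) \<Rightarrow> (rvec \<Rightarrow> complex)) \<Rightarrow> cvec \<Rightarrow> cvec \<Rightarrow> complex" where
  "berezin_ext n m hbar A w z =
     sphere_inner n (A (Phi n m hbar z)) (Phi n m hbar w) / sphere_inner n (Phi n m hbar z) (Phi n m hbar w)"

definition Aset :: "nat \<Rightarrow> nat \<Rightarrow> real \<Rightarrow> (cvec \<Rightarrow> complex) set" where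
  "Aset n m hbar = {berezin n m hbar A | A. bounded_op n A}"

text \<open>The extended symbol f(.,.) attached to f in A_(n,m) (it is determined by f).\<close>
definition ext_symbol :: "nat \<Rightarrow> nat \<Rightarrow> real \<Rightarrow> (cvec \<Rightarrow> complex) \<Rightarrow> cvec \<Rightarrow> cvec \<Rightarrow> complex" where
  "ext_symbol n m hbar f =
     berezin_ext n m hbar (SOME A. bounded_op n A \<and> berezin n m hbar A = f)"

definition star :: "nat \<Rightarrow> nat \<Rightarrow> real \<Rightarrow> (cvec \<Rightarrow> complex) \<Rightarrow> (cvec \<Rightarrow> complex) \<Rightarrow> cvec \<Rightarrow> complex" where
  "star n m hbar f1 f2 z =
     integral\<^sup>L (mu m hbar) (\<lambda>u. ext_symbol n m hbar f1 z u * ext_symbol n m hbar f2 u z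
        * complex_of_real ((cmod (Qker n m hbar u z))\<^sup>2) / Qker n m hbar z z)"

definition mmul :: "nat \<Rightarrow> cmat \<Rightarrow> cmat \<Rightarrow> cmat" where
  "mmul k A B = (\<lambda>i j. \<Sum>l<k. A i l * B l j)"

definition mdet :: "nat \<Rightarrow> cmat \<Rightarrow> complex" where
  "mdet k M = (\<Sum>p | p permutes {..<k}. of_int (sign p) * (\<Prod>i<k. M i (p i)))"

definition SU :: "nat \<Rightarrow> cmat set" where
  "SU k = {U. (\<forall>i<k. \<forall>j<k. (\<Sum>l<k. cnj (U l i) * U l j) = (if i = j then 1 else 0))
              \<and> mdet k U = 1}"

datatype felt = G_SU2 cmat | G_SU2xSU2 cmat cmat | G_SU4 cmat

definition Fgrp :: "nat \<Rightarrow> felt set" where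
  "Fgrp m = (if m = 2 then G_SU2 ` SU 2
             else if m = 4 then {G_SU2xSU2 V W | V W. V \<in> SU 2 \<and> W \<in> SU 2}
             else if m = 8 then G_SU4 ` SU 4 else {})"

definition Emat :: cmat where
  "Emat = (\<lambda>i j. if (i, j) = (0, 2) \<or> (i, j) = (2, 0) then -1
               else if (i, j) = (1, 3) \<or> (i, j) = (3, 1) then 1 else 0)"

text \<open>L(g) z; coordinates beyond m are set to 0 (they play no role).\<close>
fun Lact :: "felt \<Rightarrow> cvec \<Rightarrow> cvec" where
  "Lact (G_SU2 U) z = (\<lambda>i. if i < 2 then (\<Sum>j<2. U i j * z j) else 0)"
| "Lact (G_SU2xSU2 V W) z = (\<lambda>i. if i < 2 then (\<Sum>j<2. V i j * z j)
                               else if i < 4 then (\<Sum>j<2. W (i - 2) j * z (j + 2)) else 0)"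
| "Lact (G_SU4 U) z = (let EUE = mmul 4 (mmul 4 Emat U) Emat in
       (\<lambda>i. if i < 4 then (\<Sum>j<4. U i j * z j)
            else if i < 8 then (\<Sum>j<4. EUE (i - 4) j * z (j + 4)) else 0))"

end

theory Submission
  imports Defs "HOL-Complex_Analysis.Complex_Analysis"
begin

text \<open>There is a real orthogonal matrix \<open>R\<close> with \<open>\<rho> (L(g) z) = R (\<rho> z)\<close>. For \<open>SU(4)\<close> this is because
  \<open>\<rho>\<close> consists of coordinates on the second exterior power of \<open>\<complex>\<^sup>4\<close> that are real for the Hodge star, which
  commutes with the action of \<open>SU(4)\<close>. Hence the coherent states satisfy \<open>\<Phi>(L(g) z) = \<Phi>(z) \<circ> R\<^sup>T\<close>, and
  conjugating an operator by the rotation, which preserves the surface measure, composes its Berezin symbol with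
  \<open>L(g)\<close>. Because the extended symbol is determined by its values on the diagonal (polarization of
  sesqui-holomorphic functions), it is composed with \<open>L(g)\<close> in both arguments. Covariance of the star product is
  then the change of variables \<open>u \<mapsto> L(g) u\<close>, which is unitary and preserves \<open>\<mu>\<close>.\<close>

section \<open>Invariance of the measures under linear isometries\<close>

text \<open>The obstacle is that the star product is built on \<open>ext_symbol\<close>, which picks
  some operator with the given Berezin symbol. The operator picked for
  \<open>f \<circ> Lact g\<close> need not be the rotated copy of the one picked for
  \<open>f\<close>, so uniqueness of the extended symbol is indispensable and not a mere
  convenience. Uniqueness needs holomorphy of the form \<open>sphere_inner n (A (coh n hbar
  \<alpha>)) (coh n hbar \<beta>)\<close> in \<open>cnj \<alpha>\<close> and \<open>\<beta>\<close>.
  Since \<open>A\<close> is linear only for finite sums and up to null sets, the exponential-type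
  series is truncated: the truncated form is a polynomial, and boundedness of \<open>A\<close> makes
  the convergence locally uniform. A second obstacle is that nothing is known about measurability of
  the integrands, neither of the star product nor of the conjugated forms. Every change of variables
  is therefore made with a map that has a measurable right inverse. Finally, the measures live on
  spaces of functions on an index set, whereas rotation invariance of Lebesgue measure is a fact
  about \<open>(real, 'n) vec\<close>; it is carried over by listing all real coordinates, in a type
  of the right cardinality.\<close>

lemma distr_lborel_orthogonal:
  fixes g :: "(real, 'n::{finite,wellorder}) vec \<Rightarrow> (real, 'n) vec"
  assumes g: "orthogonal_transformation g"
  shows "distr lborel borel g = lborel"
proof (rule lborel_eqI[symmetric])
  fix l u :: "(real, 'n) vec" assume lu: "\<And>b. b \<in> Basis \<Longrightarrow> l \<bullet> b \<le> u \<bullet> b"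
  have [measurable]: "g \<in> borel_measurable borel"
    using g by (intro borel_measurable_continuous_onI linear_continuous_on)
      (simp add: orthogonal_transformation_linear linear_conv_bounded_linear[symmetric])
  have inv: "orthogonal_transformation (inv g)"
    using g by (rule orthogonal_transformation_inv)
  \<comment> \<open>Volumes of images under orthogonal maps are known, so the preimage is turned
    into an image under the inverse.\<close>
  have vim: "g -` box l u = inv g ` box l u"
    by (metis bij_vimage_eq_inv_image g orthogonal_transformation_bij)
  have b: "box l u \<in> lmeasurable" by simp
  have "g \<in> borel \<rightarrow>\<^sub>M borel"
    using g by (intro borel_measurable_continuous_onI linear_continuous_on)
      (simp add: orthogonal_transformation_linear linear_conv_bounded_linear[symmetric])
  then have "g -` box l u \<in> sets lborel"
    using measurable_sets_borel[of g borel "box l u"] by simp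
  then have "emeasure (distr lborel borel g) (box l u) = emeasure lebesgue (g -` box l u)"
    by (simp add: emeasure_distr)
  also have "\<dots> = ennreal (measure lebesgue (inv g ` box l u))"
    unfolding vim using measurable_orthogonal_image[OF inv b] by (intro emeasure_eq_measure2) auto
  also have "\<dots> = ennreal (measure lebesgue (box l u))"
    using measure_orthogonal_image[OF inv b] by simp
  also have "\<dots> = emeasure lborel (box l u)"
    using b by (subst emeasure_eq_measure2[symmetric]) auto
  finally show "emeasure (distr lborel borel g) (box l u) = (\<Prod>b\<in>Basis. (u - l) \<bullet> b)"
    using lu by simp
qed simp

text \<open>The bijection \<open>e\<close> numbers the pairs of an index and a basis vector, so
  \<open>J\<close> lists all real coordinates; this treats real and complex factors alike. A box
  pulls back to a product of boxes, and both volumes are the same product of side lengths, grouped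
  differently.\<close>

lemma distr_PiM_lborel_vec:
  fixes e :: "'p::finite \<Rightarrow> nat \<times> 'a::euclidean_space"
  assumes e: "bij_betw e UNIV ({..<k} \<times> Basis)"
  defines "J \<equiv> \<lambda>x. \<chi> j. x (fst (e j)) \<bullet> snd (e j)"
  shows "J \<in> PiM {..<k} (\<lambda>_. lborel) \<rightarrow>\<^sub>M borel"
    and "distr (PiM {..<k} (\<lambda>_. lborel)) borel J = lborel"
proof -
  interpret product_sigma_finite "\<lambda>_::nat. lborel :: 'a measure" ..
  let ?P = "PiM {..<k} (\<lambda>_. lborel :: 'a measure)"
  have ei: "fst (e j) < k" "snd (e j) \<in> Basis" for j
    using bij_betw_apply[OF e UNIV_I, of j] by (auto simp: mem_Times_iff)
  have comp: "(\<lambda>x. x (fst (e j))) \<in> ?P \<rightarrow>\<^sub>M lborel" for j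
    using ei by (intro measurable_component_singleton) auto
  have comp': "(\<lambda>x. x (fst (e j)) \<bullet> b) \<in> borel_measurable ?P" for j and b :: 'a
    using comp[of j] by (simp add: borel_measurable_inner)
  show J: "J \<in> ?P \<rightarrow>\<^sub>M borel"
    unfolding J_def
    by (subst borel_measurable_euclidean_space) (auto simp: Basis_vec_def inner_axis intro: comp')
  show "distr ?P borel J = lborel"
  proof (rule lborel_eqI[symmetric])
    fix l u :: "real^'p" assume lu: "\<And>b. b \<in> Basis \<Longrightarrow> l \<bullet> b \<le> u \<bullet> b"
    then have lu': "l $ j \<le> u $ j" for j
      using lu[of "axis j 1"] by (simp add: inner_axis)
    define ee where "ee = inv_into UNIV e"
    have ee: "ee (e j) = j" for j
      using e by (simp add: ee_def bij_betw_def)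
    have ee2: "e (ee p) = p" if "p \<in> {..<k} \<times> Basis" for p
      using e that by (simp add: ee_def bij_betw_inv_into_right)
    define B where "B = (\<lambda>v::real^'p. \<lambda>i. \<Sum>b\<in>Basis. (v $ ee (i, b)) *\<^sub>R (b::'a))"
    have Bi: "B v i \<bullet> b = v $ ee (i, b)" if "b \<in> Basis" for v i b
      using that by (simp add: B_def inner_sum_left_Basis)
    have "J -` box l u \<inter> space ?P = PiE {..<k} (\<lambda>i. box (B l i) (B u i))"
    proof (intro set_eqI iffI)
      fix x assume "x \<in> J -` box l u \<inter> space ?P"
      then have x: "x \<in> extensional {..<k}"
        and *: "\<And>j. l $ j < x (fst (e j)) \<bullet> snd (e j)" "\<And>j. x (fst (e j)) \<bullet> snd (e j) < u $ j"
        by (auto simp: J_def space_PiM mem_box_cart PiE_def)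
      have "l $ ee (i, b) < x i \<bullet> b" "x i \<bullet> b < u $ ee (i, b)" if "i < k" "b \<in> Basis" for i b
        using *[of "ee (i, b)"] ee2[of "(i, b)"] that by auto
      with x show "x \<in> PiE {..<k} (\<lambda>i. box (B l i) (B u i))"
        by (auto simp: PiE_iff mem_box Bi)
    next
      fix x assume x: "x \<in> PiE {..<k} (\<lambda>i. box (B l i) (B u i))"
      have eq: "ee (fst (e j), snd (e j)) = j" for j
        by (simp add: ee)
      have "l $ j < x (fst (e j)) \<bullet> snd (e j) \<and> x (fst (e j)) \<bullet> snd (e j) < u $ j" for j
        using x ei[of j] eq[of j] by (force simp: PiE_iff mem_box Bi)
      with x show "x \<in> J -` box l u \<inter> space ?P"
        by (auto simp: J_def space_PiM mem_box_cart)
    qed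
    then have "emeasure (distr ?P borel J) (box l u) = (\<Prod>i<k. emeasure lborel (box (B l i) (B u i)))"
      using J by (simp add: emeasure_distr emeasure_PiM)
    also have "\<dots> = (\<Prod>i<k. ennreal (\<Prod>b\<in>Basis. u $ ee (i, b) - l $ ee (i, b)))"
      using lu' by (intro prod.cong) (auto simp: emeasure_lborel_box_eq Bi inner_diff_left intro!: prod.cong)
    also have "\<dots> = ennreal (\<Prod>p\<in>{..<k} \<times> Basis. u $ ee p - l $ ee p)"
      using lu' by (subst prod_ennreal) (auto simp: prod.cartesian_product intro!: prod_nonneg)
    also have "(\<Prod>p\<in>{..<k} \<times> Basis. u $ ee p - l $ ee p) = (\<Prod>j\<in>UNIV. u $ j - l $ j)"
      using prod.reindex_bij_betw[OF e, of "\<lambda>p. u $ ee p - l $ ee p"] by (simp add: ee)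
    also have "\<dots> = (\<Prod>b\<in>Basis. (u - l) \<bullet> b)"
    proof -
      have B: "(Basis :: (real^'p) set) = range (\<lambda>j. axis j 1)"
        by (auto simp: Basis_vec_def)
      show ?thesis
        unfolding B by (subst prod.reindex) (auto simp: inj_on_def axis_eq_axis inner_axis)
    qed
    finally show "emeasure (distr ?P borel J) (box l u) = ennreal (\<Prod>b\<in>Basis. (u - l) \<bullet> b)" .
  qed simp
qed

text \<open>Conjugated by the coordinate map \<open>J\<close>, the isometry becomes an orthogonal
  transformation \<open>g\<close>, whose inverse also yields the right inverse of \<open>T\<close>.
  The entries \<open>M i j\<close> are real-linear maps, which covers multiplication by real and by
  complex matrix entries.\<close>

lemma PiM_lborel_isometry:
  fixes M :: "nat \<Rightarrow> nat \<Rightarrow> 'a::euclidean_space \<Rightarrow> 'a"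
  assumes card: "CARD('p::{finite,wellorder}) = k * DIM('a)"
    and lin: "\<And>i j. i < k \<Longrightarrow> j < k \<Longrightarrow> linear (M i j)"
    and isom: "\<And>x. (\<Sum>i<k. (norm (\<Sum>j<k. M i j (x j)))\<^sup>2) = (\<Sum>i<k. (norm (x i))\<^sup>2)"
  defines "P \<equiv> PiM {..<k} (\<lambda>_. lborel :: 'a measure)"
    and "T \<equiv> \<lambda>x. \<lambda>i\<in>{..<k}. \<Sum>j<k. M i j (x j)"
  shows "T \<in> P \<rightarrow>\<^sub>M P" and "distr P P T = P"
    and "\<exists>T'\<in>P \<rightarrow>\<^sub>M P. \<forall>x\<in>space P. T (T' x) = x"
proof -
  have "card (UNIV :: 'p set) = card ({..<k} \<times> (Basis :: 'a set))"
    using card by (simp add: card_cartesian_product)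
  then obtain e :: "'p \<Rightarrow> nat \<times> 'a" where e: "bij_betw e UNIV ({..<k} \<times> Basis)"
    by (meson finite finite_Basis finite_SigmaI finite_lessThan finite_same_card_bij)
  have ei: "fst (e j) < k" "snd (e j) \<in> Basis" for j
    using bij_betw_apply[OF e UNIV_I, of j] by (auto simp: mem_Times_iff)
  define ee where "ee = inv_into UNIV e"
  have ee: "ee (e j) = j" for j
    using e by (simp add: ee_def bij_betw_def)
  have ee2: "e (ee p) = p" if "p \<in> {..<k} \<times> Basis" for p
    using e that by (simp add: ee_def bij_betw_inv_into_right)
  define J :: "(nat \<Rightarrow> 'a) \<Rightarrow> (real, 'p) vec" where "J = (\<lambda>x. \<chi> j. x (fst (e j)) \<bullet> snd (e j))"
  define B where "B = (\<lambda>v::(real, 'p) vec. \<lambda>i. \<Sum>b\<in>Basis. (v $ ee (i, b)) *\<^sub>R (b::'a))"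
  \<comment> \<open>Points of the product space are \<open>undefined\<close> outside the index set,
    so only the restricted map inverts \<open>J\<close> on that space.\<close>
  define K where "K = (\<lambda>v. restrict (B v) {..<k})"
  have J: "J \<in> P \<rightarrow>\<^sub>M borel" "distr P borel J = lborel"
    using distr_PiM_lborel_vec[OF e] by (simp_all add: J_def P_def)
  have Bi: "B v i \<bullet> b = v $ ee (i, b)" if "b \<in> Basis" for v i b
    using that by (simp add: B_def inner_sum_left_Basis)
  have Blin: "linear (\<lambda>v. B v i)" for i
    by (rule linearI) (auto simp: B_def scaleR_left_distrib sum.distrib scaleR_sum_right)
  have Bmeas: "(\<lambda>v. B v i) \<in> borel_measurable borel" for i
    using Blin by (intro borel_measurable_continuous_onI linear_continuous_on)
      (simp add: linear_conv_bounded_linear[symmetric])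
  have K: "K \<in> borel \<rightarrow>\<^sub>M P"
    unfolding K_def P_def using Bmeas by (intro measurable_restrict) auto
  have JB: "J (B v) = v" for v
    using ei by (simp add: J_def vec_eq_iff Bi ee)
  have JK: "J (K v) = v" for v
    using ei by (simp add: J_def K_def vec_eq_iff Bi ee)
  have KJ: "K (J x) = x" if "x \<in> space P" for x
  proof
    fix i
    show "K (J x) i = x i"
    proof (cases "i < k")
      case True
      have "B (J x) i \<bullet> b = x i \<bullet> b" if "b \<in> Basis" for b
        using that True ee2[of "(i, b)"] by (simp add: Bi J_def)
      with True show ?thesis
        by (simp add: K_def euclidean_eq_iff[of "B (J x) i"])
    next
      case False
      with that show ?thesis
        by (auto simp: K_def P_def space_PiM PiE_iff extensional_def)
    qed
  qed
  have norm_J: "(norm (J x))\<^sup>2 = (\<Sum>i<k. (norm (x i))\<^sup>2)" for x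
  proof -
    have "(norm (J x))\<^sup>2 = (\<Sum>j\<in>UNIV. (x (fst (e j)) \<bullet> snd (e j))\<^sup>2)"
      by (simp add: norm_vec_def L2_set_def sum_nonneg J_def)
    also have "\<dots> = (\<Sum>p\<in>{..<k} \<times> Basis. (x (fst p) \<bullet> snd p)\<^sup>2)"
      by (rule sum.reindex_bij_betw[OF e])
    also have "\<dots> = (\<Sum>i<k. \<Sum>b\<in>Basis. (x i \<bullet> b)\<^sup>2)"
      by (simp add: sum.cartesian_product case_prod_unfold)
    also have "\<dots> = (\<Sum>i<k. (norm (x i))\<^sup>2)"
    proof (rule sum.cong)
      fix i
      show "(\<Sum>b\<in>Basis. (x i \<bullet> b)\<^sup>2) = (norm (x i))\<^sup>2"
        unfolding power2_norm_eq_inner euclidean_inner[of "x i" "x i"] by (simp add: power2_eq_square)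
    qed simp
    finally show ?thesis .
  qed
  define S where "S = (\<lambda>v. \<lambda>i. \<Sum>j<k. M i j (B v j))"
  define g where "g = (\<lambda>v. J (S v))"
  have TK: "T (K v) = restrict (S v) {..<k}" for v
    by (auto simp: T_def K_def S_def restrict_def intro!: sum.cong)
  have J_restrict: "J (restrict x {..<k}) = J x" for x
    using ei by (simp add: J_def vec_eq_iff)
  have JTK: "J (T (K v)) = g v" for v
    by (simp add: TK J_restrict g_def)
  have g: "orthogonal_transformation g"
    unfolding orthogonal_transformation
  proof
    have "linear (\<lambda>v. S v i)" if "i < k" for i
      unfolding S_def using lin that linear_compose[OF Blin lin]
      by (intro linear_compose_sum) (auto simp: o_def)
    then have "linear (\<lambda>v. S v (fst (e j)) \<bullet> snd (e j))" for j
      using linear_compose[of "\<lambda>v. S v (fst (e j))" "\<lambda>x. x \<bullet> snd (e j)"] ei[of j]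
      by (simp add: o_def linear_conv_bounded_linear bounded_linear_inner_left)
    then show "linear g"
      unfolding g_def J_def by (simp add: linear_iff vec_eq_iff)
    show "\<forall>v. norm (g v) = norm v"
    proof
      fix v
      have "(norm (g v))\<^sup>2 = (\<Sum>i<k. (norm (B v i))\<^sup>2)"
        by (simp add: g_def norm_J S_def isom)
      also have "\<dots> = (norm v)\<^sup>2"
        by (simp add: norm_J[symmetric] JB)
      finally show "norm (g v) = norm v" by simp
    qed
  qed
  have meas_orth: "h \<in> borel \<rightarrow>\<^sub>M borel" if "orthogonal_transformation h" for h :: "(real, 'p) vec \<Rightarrow> (real, 'p) vec"
    using that by (intro borel_measurable_continuous_onI linear_continuous_on)
      (simp add: orthogonal_transformation_linear linear_conv_bounded_linear[symmetric])
  have T_space: "T x \<in> space P" for x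
    by (auto simp: T_def P_def space_PiM)
  have T_eq: "T x = K (g (J x))" if "x \<in> space P" for x
    using KJ[OF that] JTK[of "J x"] KJ[OF T_space[of x]] by simp
  have KgJ: "(\<lambda>x. K (h (J x))) \<in> P \<rightarrow>\<^sub>M P" if "orthogonal_transformation h" for h
    using measurable_compose[OF measurable_compose[OF J(1) meas_orth[OF that]] K] .
  show "T \<in> P \<rightarrow>\<^sub>M P"
    using KgJ[OF g] T_eq by (simp cong: measurable_cong)
  have "distr P P T = distr P P (\<lambda>x. K (g (J x)))"
    using T_eq by (intro distr_cong) auto
  also have "\<dots> = distr (distr (distr P borel J) borel g) P K"
    using J(1) K meas_orth[OF g] by (simp add: distr_distr o_def)
  also have "\<dots> = distr lborel P K"
    using distr_lborel_orthogonal[OF g] J(2) by simp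
  also have "\<dots> = distr (distr P borel J) P K"
    using J(2) by simp
  also have "\<dots> = distr P P (\<lambda>x. x)"
  proof -
    have "distr P P (K \<circ> J) = distr P P (\<lambda>x. x)"
      by (intro distr_cong) (auto simp: KJ)
    with J(1) K show ?thesis by (simp add: distr_distr)
  qed
  finally show "distr P P T = P" by simp
  show "\<exists>T'\<in>P \<rightarrow>\<^sub>M P. \<forall>x\<in>space P. T (T' x) = x"
  proof (intro bexI ballI)
    have inv: "orthogonal_transformation (inv g)"
      using g by (rule orthogonal_transformation_inv)
    show "(\<lambda>x. K (inv g (J x))) \<in> P \<rightarrow>\<^sub>M P"
      by (rule KgJ[OF inv])
    fix x assume x: "x \<in> space P"
    have "T (K (inv g (J x))) = K (J (T (K (inv g (J x)))))"
      using KJ[OF T_space] by simp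
    also have "\<dots> = x"
      using x orthogonal_transformation_surj[OF g] by (simp add: JTK surj_f_inv_f KJ)
    finally show "T (K (inv g (J x))) = x" .
  qed
qed

text \<open>The right inverse of \<open>T\<close> makes \<open>h \<circ> T\<close> non-measurable when \<open>h\<close> is; both integrals are then 0 by
  convention.\<close>
lemma integral_invariant:
  fixes h :: "'a \<Rightarrow> 'b::{banach, second_countable_topology}"
  assumes T: "T \<in> M \<rightarrow>\<^sub>M M" and inv: "distr M M T = M"
    and T': "\<exists>T'\<in>M \<rightarrow>\<^sub>M M. \<forall>x\<in>space M. T (T' x) = x"
  shows "integral\<^sup>L M (\<lambda>x. h (T x)) = integral\<^sup>L M h"
proof (cases "h \<in> borel_measurable M")
  case True
  then show ?thesis
    using integral_distr[OF T True] inv by simp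
next
  case False
  obtain T' where T': "T' \<in> M \<rightarrow>\<^sub>M M" "\<And>x. x \<in> space M \<Longrightarrow> T (T' x) = x"
    using T' by auto
  have "(\<lambda>x. h (T x)) \<notin> borel_measurable M"
  proof
    assume "(\<lambda>x. h (T x)) \<in> borel_measurable M"
    from measurable_compose[OF T'(1) this] have "(\<lambda>x. h (T (T' x))) \<in> borel_measurable M" .
    with T'(2) have "h \<in> borel_measurable M" by (simp cong: measurable_cong)
    with False show False ..
  qed
  with False show ?thesis
    by (metis borel_measurable_integrable not_integrable_integral_eq)
qed

text \<open>Lebesgue measure is invariant and the Gaussian density depends only on the norm. The
  type \<open>'p\<close> enters through its cardinality alone, the real dimension of the
  space.\<close>

lemma mu_isometry:
  fixes U :: cmat
  assumes card: "CARD('p::{finite,wellorder}) = 2 * m"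
    and isom: "\<And>x. cnormsq m (\<lambda>i. \<Sum>j<m. U i j * x j) = cnormsq m x"
  defines "T \<equiv> \<lambda>x. \<lambda>i\<in>{..<m}. \<Sum>j<m. U i j * x j"
  shows "integral\<^sup>L (mu m hbar) (\<lambda>x. h (T x) :: complex) = integral\<^sup>L (mu m hbar) h"
proof -
  have c: "CARD('p) = m * DIM(complex)" using card by simp
  have l: "linear (\<lambda>z. U i j * z)" for i j
    by (simp add: linear_conv_bounded_linear bounded_linear_mult_right)
  have i: "(\<Sum>i<m. (cmod (\<Sum>j<m. U i j * x j))\<^sup>2) = (\<Sum>i<m. (cmod (x i))\<^sup>2)" for x
    using isom[of x] by (simp add: cnormsq_def)
  note * = PiM_lborel_isometry[where M = "\<lambda>i j z. U i j * z", OF c l i, folded lebC_def]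
  have T: "T \<in> lebC m \<rightarrow>\<^sub>M lebC m" "distr (lebC m) (lebC m) T = lebC m"
    "\<exists>T'\<in>lebC m \<rightarrow>\<^sub>M lebC m. \<forall>x\<in>space (lebC m). T (T' x) = x"
    using * unfolding T_def by simp_all
  define f where "f = (\<lambda>z. ennreal ((pi * hbar) powi (- int m) * exp (- cnormsq m z / hbar)))"
  have fT: "f (T x) = f x" for x
    using isom[of x] by (simp add: f_def T_def cnormsq_def)
  have mu: "mu m hbar = density (lebC m) f"
    by (simp add: mu_def f_def)
  have [measurable]: "f \<in> borel_measurable (lebC m)"
    unfolding f_def cnormsq_def lebC_def by measurable
  show ?thesis
  proof (rule integral_invariant)
    have [simp]: "sets (mu m hbar) = sets (lebC m)" "space (mu m hbar) = space (lebC m)"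
      by (simp_all add: mu)
    show "T \<in> mu m hbar \<rightarrow>\<^sub>M mu m hbar"
      "\<exists>T'\<in>mu m hbar \<rightarrow>\<^sub>M mu m hbar. \<forall>x\<in>space (mu m hbar). T (T' x) = x"
      using T by (simp_all cong: measurable_cong_sets)
    have "distr (mu m hbar) (mu m hbar) T = distr (density (lebC m) (\<lambda>x. f (T x))) (lebC m) T"
      by (simp add: mu fT cong: distr_cong)
    also have "\<dots> = density (distr (lebC m) (lebC m) T) f"
      using T(1) by (intro density_distr[symmetric]) auto
    finally show "distr (mu m hbar) (mu m hbar) T = mu m hbar"
      using T(2) by (simp add: mu)
  qed
qed

section \<open>Rotation invariance and finiteness of the surface measure\<close>

lemma finite_measure_uniform_measure:
  assumes "A \<in> sets M"
  shows "finite_measure (uniform_measure M A)"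
proof -
  \<comment> \<open>The quotients 0/0 and infinity/infinity are 0 here, so the volume of the ball
    never has to be computed.\<close>
  have "emeasure M A / emeasure M A < \<infinity>"
    by (cases "emeasure M A"; cases "emeasure M A = 0")
      (auto simp: divide_ennreal_def ennreal_mult_less_top inverse_ennreal)
  with assms show ?thesis
    by (intro finite_measureI) (simp add: emeasure_uniform_measure sets.sets_into_space Int_absorb2 less_top)
qed

text \<open>An isometry preserves Lebesgue measure and the ball and commutes with the radial
  projection, hence it preserves the push-forward.\<close>

lemma sphere_measure_isometry:
  fixes R :: "nat \<Rightarrow> nat \<Rightarrow> real"
  assumes card: "CARD('p::{finite,wellorder}) = Suc n"
    and isom: "\<And>x. (\<Sum>i<Suc n. (\<Sum>j<Suc n. R i j * x j)\<^sup>2) = (\<Sum>i<Suc n. (x i)\<^sup>2)"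
  defines "M \<equiv> sphere_measure n"
    and "T \<equiv> \<lambda>x. \<lambda>i\<in>{..<Suc n}. \<Sum>j<Suc n. R i j * x j"
  shows "T \<in> M \<rightarrow>\<^sub>M M" and "distr M M T = M"
    and "\<exists>T'\<in>M \<rightarrow>\<^sub>M M. \<forall>x\<in>space M. T (T' x) = x"
proof -
  define k where "k = Suc n"
  have MD: "M = distr (uniform_measure (lebR k) (unit_ball k)) (lebR k) (radial_proj k)"
    by (simp add: M_def sphere_measure_def k_def)
  have TD: "T = (\<lambda>x. \<lambda>i\<in>{..<k}. \<Sum>j<k. R i j * x j)"
    by (simp add: T_def k_def)
  note isom = isom[folded k_def]
  let ?L = "lebR k"
  let ?B = "unit_ball k"
  have c: "CARD('p) = k * DIM(real)" using card by (simp add: k_def)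
  have l: "linear (\<lambda>z. R i j * z)" for i j
    by (simp add: linear_conv_bounded_linear bounded_linear_mult_right)
  have i: "(\<Sum>i<k. (norm (\<Sum>j<k. R i j * x j))\<^sup>2) = (\<Sum>i<k. (norm (x i))\<^sup>2)" for x
    using isom[of x] by simp
  note * = PiM_lborel_isometry[where M = "\<lambda>i j z. R i j * z", OF c l i, folded lebR_def]
  have T: "T \<in> ?L \<rightarrow>\<^sub>M ?L" "distr ?L ?L T = ?L"
    "\<exists>T'\<in>?L \<rightarrow>\<^sub>M ?L. \<forall>x\<in>space ?L. T (T' x) = x"
    using * unfolding TD by simp_all
  have setsM [simp]: "sets M = sets ?L" "space M = space ?L"
    by (simp_all add: MD)
  show TM: "T \<in> M \<rightarrow>\<^sub>M M" "\<exists>T'\<in>M \<rightarrow>\<^sub>M M. \<forall>x\<in>space M. T (T' x) = x"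
    using T by (simp_all cong: measurable_cong_sets)
  have normT: "(\<Sum>i<k. (T x i)\<^sup>2) = (\<Sum>i<k. (x i)\<^sup>2)" for x
    using isom[of x] by (simp add: TD)
  have ball [measurable]: "?B \<in> sets ?L"
    unfolding unit_ball_def lebR_def by measurable
  have proj: "radial_proj k \<in> ?L \<rightarrow>\<^sub>M ?L"
    unfolding radial_proj_def lebR_def by measurable
  define f where "f = (\<lambda>x. indicator ?B x / emeasure ?L ?B :: ennreal)"
  have f [measurable]: "f \<in> borel_measurable ?L"
    unfolding f_def by measurable
  have fT: "f (T x) = f x" if "x \<in> space ?L" for x
    using that measurable_space[OF T(1) that] normT[of x]
    by (simp add: f_def unit_ball_def indicator_def)
  have U: "uniform_measure ?L ?B = density ?L f"
    by (simp add: uniform_measure_def f_def)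
  have TU: "distr (density ?L f) ?L T = density ?L f"
  proof -
    have "density ?L f = density ?L (\<lambda>x. f (T x))"
      using T(1) fT by (intro density_cong) (auto intro!: measurable_compose[OF T(1)])
    then have "distr (density ?L f) ?L T = density (distr ?L ?L T) f"
      using T(1) by (simp add: density_distr)
    with T(2) show ?thesis by simp
  qed
  have comm: "T (radial_proj k x) = radial_proj k (T x)" for x
  proof
    fix i
    have "(\<Sum>j<k. R i j * radial_proj k x j) = (\<Sum>j<k. R i j * x j) / sqrt (\<Sum>j<k. (x j)\<^sup>2)"
      by (simp add: radial_proj_def sum_divide_distrib)
    then show "T (radial_proj k x) i = radial_proj k (T x) i"
      using normT[of x] by (simp add: TD radial_proj_def)
  qed
  have "distr M M T = distr (distr (density ?L f) ?L (radial_proj k)) ?L T"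
    by (intro distr_cong) (auto simp: MD U)
  also have "\<dots> = distr (distr (density ?L f) ?L T) ?L (radial_proj k)"
    using T(1) proj by (simp add: distr_distr o_def comm)
  also have "\<dots> = M"
    by (simp add: TU MD U)
  finally show "distr M M T = M" .
qed

lemma finite_measure_sphere: "finite_measure (sphere_measure n)"
proof -
  have "unit_ball (Suc n) \<in> sets (lebR (Suc n))"
    unfolding unit_ball_def lebR_def by measurable
  then interpret finite_measure "uniform_measure (lebR (Suc n)) (unit_ball (Suc n))"
    by (rule finite_measure_uniform_measure)
  have "radial_proj (Suc n) \<in> lebR (Suc n) \<rightarrow>\<^sub>M lebR (Suc n)"
    unfolding radial_proj_def lebR_def by measurable
  then show ?thesis
    unfolding sphere_measure_def by (intro finite_measure_distr) simp
qed

text \<open>An inequality is enough to bound coherent states, and it holds at every point: the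
  radial projection sends the origin to 0 because of division by zero.\<close>

lemma AE_sphere: "AE x in sphere_measure n. (\<Sum>i<Suc n. (x i)\<^sup>2) \<le> 1"
proof -
  have proj: "radial_proj (Suc n) \<in> lebR (Suc n) \<rightarrow>\<^sub>M lebR (Suc n)"
    unfolding radial_proj_def lebR_def by measurable
  have "(\<Sum>i<k. (radial_proj k x i)\<^sup>2) \<le> 1" for k x
  proof -
    define N where "N = (\<Sum>j<k. (x j)\<^sup>2)"
    have "N \<ge> 0" by (simp add: N_def sum_nonneg)
    then have "(\<Sum>i<k. (radial_proj k x i)\<^sup>2) = N / N"
      by (simp add: radial_proj_def power_divide sum_divide_distrib[symmetric] flip: N_def)
    also have "\<dots> \<le> 1" by simp
    finally show ?thesis .
  qed
  then have "AE x in uniform_measure (lebR (Suc n)) (unit_ball (Suc n)).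
      (\<Sum>i<Suc n. (radial_proj (Suc n) x i)\<^sup>2) \<le> 1"
    by (simp del: sum.lessThan_Suc)
  moreover have "{x \<in> space (lebR (Suc n)). (\<Sum>i<Suc n. (x i)\<^sup>2) \<le> 1} \<in> sets (lebR (Suc n))"
    unfolding lebR_def by measurable
  ultimately show ?thesis
    unfolding sphere_measure_def using proj by (subst AE_distr_iff) (auto simp del: sum.lessThan_Suc)
qed

section \<open>Covariance of the quadratic maps\<close>

text \<open>The scalar \<open>c\<close> lets \<open>rho_mat\<close> (with \<open>c = 2\<close>) and
  its inverse (with \<open>c = 1/2\<close>) enter products like unitary matrices, without square
  roots for normalization.\<close>

definition scaled_unitary :: "nat \<Rightarrow> complex \<Rightarrow> cmat \<Rightarrow> bool" where
  "scaled_unitary k c U \<longleftrightarrow> (\<forall>i<k. \<forall>j<k. (\<Sum>l<k. cnj (U l i) * U l j) = (if i = j then c else 0))"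

lemma scaled_unitaryD:
  "scaled_unitary k c U \<Longrightarrow> i < k \<Longrightarrow> j < k \<Longrightarrow> (\<Sum>l<k. cnj (U l i) * U l j) = (if i = j then c else 0)"
  by (simp add: scaled_unitary_def)

lemma SU_scaled_unitary: "U \<in> SU k \<Longrightarrow> scaled_unitary k 1 U"
  by (simp add: SU_def scaled_unitary_def)

lemma scaled_unitary_form:
  assumes "scaled_unitary k c U"
  shows "(\<Sum>i<k. cnj (\<Sum>j<k. U i j * x j) * (\<Sum>j<k. U i j * y j)) = c * (\<Sum>j<k. cnj (x j) * y j)"
proof -
  have "(\<Sum>i<k. cnj (\<Sum>j<k. U i j * x j) * (\<Sum>j<k. U i j * y j))
      = (\<Sum>i<k. \<Sum>a<k. \<Sum>b<k. cnj (x a) * y b * (cnj (U i a) * U i b))"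
    by (simp add: sum_product, intro sum.cong refl, simp add: mult_ac)
  also have "\<dots> = (\<Sum>a<k. \<Sum>b<k. \<Sum>i<k. cnj (x a) * y b * (cnj (U i a) * U i b))"
    by (subst sum.swap, rule sum.cong, simp, subst sum.swap, simp)
  also have "\<dots> = (\<Sum>a<k. \<Sum>b<k. if a = b then cnj (x a) * y b * c else 0)"
    using assms by (intro sum.cong refl) (simp add: scaled_unitary_def flip: sum_distrib_left)
  also have "\<dots> = c * (\<Sum>j<k. cnj (x j) * y j)"
    by (simp add: sum_distrib_left mult_ac)
  finally show ?thesis .
qed

lemma of_real_cnormsq: "complex_of_real (cnormsq k x) = (\<Sum>i<k. cnj (x i) * x i)"
  unfolding cnormsq_def of_real_sum complex_norm_square by (simp add: mult.commute)

lemma cnormsq_scaled_unitary: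
  assumes "scaled_unitary k 1 U"
  shows "cnormsq k (\<lambda>i. \<Sum>j<k. U i j * x j) = cnormsq k x"
proof -
  have "complex_of_real (cnormsq k (\<lambda>i. \<Sum>j<k. U i j * x j)) = complex_of_real (cnormsq k x)"
    using scaled_unitary_form[OF assms, of x x] by (simp add: of_real_cnormsq)
  then show ?thesis by (simp only: of_real_eq_iff)
qed

lemma scaled_unitary_mmul:
  assumes "scaled_unitary k a A" and "scaled_unitary k b B"
  shows "scaled_unitary k (a * b) (mmul k A B)"
  using assms(2) scaled_unitary_form[OF assms(1)]
  by (simp add: scaled_unitary_def mmul_def)

lemma mmul_transpose: "(\<lambda>i j. mmul k A B j i) = mmul k (\<lambda>i j. B j i) (\<lambda>i j. A j i)"
  by (simp add: mmul_def mult.commute)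

section \<open>Determinants of size 2 and 4, and the shape of SU(2) matrices\<close>

lemma mdet_2: "mdet 2 M = M 0 0 * M 1 1 - M 0 1 * M 1 0"
proof -
  have s: "{..<2} = {0, 1::nat}" by auto
  have f: "finite {1::nat}" "0 \<notin> {1::nat}" by auto
  show ?thesis
    unfolding mdet_def s
    unfolding sum_over_permutations_insert[OF f]
    unfolding permutes_sing
    by (simp add: sign_swap_id sign_id swap_id_eq)
qed

lemma mdet_4:
  "mdet 4 M =
     M 0 0 * M 1 1 * M 2 2 * M 3 3 - M 0 0 * M 1 1 * M 2 3 * M 3 2
   - M 0 0 * M 1 2 * M 2 1 * M 3 3 + M 0 0 * M 1 2 * M 2 3 * M 3 1
   + M 0 0 * M 1 3 * M 2 1 * M 3 2 - M 0 0 * M 1 3 * M 2 2 * M 3 1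
   - M 0 1 * M 1 0 * M 2 2 * M 3 3 + M 0 1 * M 1 0 * M 2 3 * M 3 2
   + M 0 1 * M 1 2 * M 2 0 * M 3 3 - M 0 1 * M 1 2 * M 2 3 * M 3 0
   - M 0 1 * M 1 3 * M 2 0 * M 3 2 + M 0 1 * M 1 3 * M 2 2 * M 3 0
   + M 0 2 * M 1 0 * M 2 1 * M 3 3 - M 0 2 * M 1 0 * M 2 3 * M 3 1
   - M 0 2 * M 1 1 * M 2 0 * M 3 3 + M 0 2 * M 1 1 * M 2 3 * M 3 0
   + M 0 2 * M 1 3 * M 2 0 * M 3 1 - M 0 2 * M 1 3 * M 2 1 * M 3 0
   - M 0 3 * M 1 0 * M 2 1 * M 3 2 + M 0 3 * M 1 0 * M 2 2 * M 3 1
   + M 0 3 * M 1 1 * M 2 0 * M 3 2 - M 0 3 * M 1 1 * M 2 2 * M 3 0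
   - M 0 3 * M 1 2 * M 2 0 * M 3 1 + M 0 3 * M 1 2 * M 2 1 * M 3 0"
proof -
  have s: "{..<4} = {0, 1, 2, 3::nat}" by auto
  have f: "finite {1, 2, 3::nat}" "0 \<notin> {1, 2, 3::nat}" "finite {2, 3::nat}" "1 \<notin> {2, 3::nat}"
      "finite {3::nat}" "2 \<notin> {3::nat}" by auto
  show ?thesis
    unfolding mdet_def s
    unfolding sum_over_permutations_insert[OF f(1,2)]
    unfolding sum_over_permutations_insert[OF f(3,4)]
    unfolding sum_over_permutations_insert[OF f(5,6)]
    unfolding permutes_sing
    by (simp add: sign_swap_id permutation_swap_id permutation_compose sign_compose sign_id
      swap_id_eq algebra_simps)
qed

lemma SU_2:
  assumes "U \<in> SU 2"
  shows "U 1 1 = cnj (U 0 0)" and "U 1 0 = - cnj (U 0 1)"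
    and "U 0 0 * cnj (U 0 0) + U 0 1 * cnj (U 0 1) = 1"
proof -
  let ?a = "U 0 0" and ?b = "U 0 1" and ?c = "U 1 0" and ?d = "U 1 1"
  have u: "i < 2 \<Longrightarrow> j < 2 \<Longrightarrow> cnj (U 0 i) * U 0 j + cnj (U 1 i) * U 1 j = (if i = j then 1 else 0)" for i j
    using assms by (simp add: SU_def eval_nat_numeral)
  have 1: "cnj ?a * ?a + cnj ?c * ?c = 1" using u[of 0 0] by simp
  have 2: "cnj ?a * ?b + cnj ?c * ?d = 0" using u[of 0 1] by simp
  have 3: "cnj ?b * ?a + cnj ?d * ?c = 0" using u[of 1 0] by simp
  have 4: "cnj ?b * ?b + cnj ?d * ?d = 1" using u[of 1 1] by simp
  have d: "?a * ?d - ?b * ?c = 1" using assms by (simp add: SU_def mdet_2)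
  show dd: "?d = cnj ?a" using 1 2 d by algebra
  show cc: "?c = - cnj ?b" using 3 4 d by algebra
  show "?a * cnj ?a + ?b * cnj ?b = 1"
    using d unfolding dd cc by simp
qed

section \<open>The real orthogonal matrices induced on the values of the quadratic maps\<close>

text \<open>Entries stay complex, with reality as a separate condition, so that they can be
  polynomials in the entries of the group element and their conjugates. Orthogonality of rows and of
  columns makes both the matrix and its transpose act as rotations.\<close>

definition real_orthogonal :: "nat \<Rightarrow> cmat \<Rightarrow> bool" where
  "real_orthogonal k R \<longleftrightarrow> (\<forall>i<k. \<forall>j<k. cnj (R i j) = R i j
     \<and> (\<Sum>l<k. R i l * R j l) = (if i = j then 1 else 0)
     \<and> (\<Sum>l<k. R l i * R l j) = (if i = j then 1 else 0))"

lemma real_orthogonalE: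
  assumes "real_orthogonal k R"
  obtains Q :: "nat \<Rightarrow> nat \<Rightarrow> real"
  where "\<And>i j. i < k \<Longrightarrow> j < k \<Longrightarrow> complex_of_real (Q i j) = R i j"
    and "\<And>i j. i < k \<Longrightarrow> j < k \<Longrightarrow> (\<Sum>l<k. Q i l * Q j l) = (if i = j then 1 else 0)"
    and "\<And>i j. i < k \<Longrightarrow> j < k \<Longrightarrow> (\<Sum>l<k. Q l i * Q l j) = (if i = j then 1 else 0)"
proof (rule that[of "\<lambda>i j. Re (R i j)"])
  have Q: "complex_of_real (Re (R i j)) = R i j" if "i < k" "j < k" for i j
    using assms that by (simp add: complex_eq_iff real_orthogonal_def)
  then show "complex_of_real (Re (R i j)) = R i j" if "i < k" "j < k" for i j
    using that .
  show "(\<Sum>l<k. Re (R i l) * Re (R j l)) = (if i = j then 1 else 0)" if "i < k" "j < k" for i j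
  proof -
    have "complex_of_real (\<Sum>l<k. Re (R i l) * Re (R j l)) = (\<Sum>l<k. R i l * R j l)"
      using that by (simp add: Q)
    also have "\<dots> = complex_of_real (if i = j then 1 else 0)"
      using assms that by (simp add: real_orthogonal_def)
    finally show ?thesis by (simp only: of_real_eq_iff)
  qed
  show "(\<Sum>l<k. Re (R l i) * Re (R l j)) = (if i = j then 1 else 0)" if "i < k" "j < k" for i j
  proof -
    have "complex_of_real (\<Sum>l<k. Re (R l i) * Re (R l j)) = (\<Sum>l<k. R l i * R l j)"
      using that by (simp add: Q)
    also have "\<dots> = complex_of_real (if i = j then 1 else 0)"
      using assms that by (simp add: real_orthogonal_def)
    finally show ?thesis by (simp only: of_real_eq_iff)
  qed
qed

text \<open>These resolve the Kronecker delta first, so that each matrix entry leaves a plain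
  polynomial identity.\<close>

lemma eq_if_TrueI: "P \<Longrightarrow> x = a \<Longrightarrow> x = (if P then a else b)"
  and eq_if_FalseI: "\<not> P \<Longrightarrow> x = b \<Longrightarrow> x = (if P then a else b)"
  by simp_all

lemma sum_lessThan_numeral:
  fixes f :: "nat \<Rightarrow> 'a::comm_monoid_add"
  shows "(\<Sum>l<2. f l) = f 0 + f 1"
    and "(\<Sum>l<3. f l) = f 0 + f 1 + f 2"
    and "(\<Sum>l<4. f l) = f 0 + f 1 + f 2 + f 3"
    and "(\<Sum>l<6. f l) = f 0 + f 1 + f 2 + f 3 + f 4 + f 5"
  by (simp_all add: eval_nat_numeral)

lemma less_numeral_cases:
  fixes i :: nat
  shows "i < 3 \<longleftrightarrow> i = 0 \<or> i = 1 \<or> i = 2"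
    and "i < 4 \<longleftrightarrow> i = 0 \<or> i = 1 \<or> i = 2 \<or> i = 3"
    and "i < 6 \<longleftrightarrow> i = 0 \<or> i = 1 \<or> i = 2 \<or> i = 3 \<or> i = 4 \<or> i = 5"
  by auto

lemma rho_2:
  "rho 2 2 z 0 = 1/2 * ((z 1)\<^sup>2 - (z 0)\<^sup>2)"
  "rho 2 2 z 1 = \<i> * (1/2 * ((z 0)\<^sup>2 + (z 1)\<^sup>2))"
  "rho 2 2 z 2 = z 0 * z 1"
  by (simp_all add: rho_def)

text \<open>The components of \<open>rho 2 2\<close> form a basis of the quadratic forms in two
  variables, so SU(2) acts on them linearly; in this basis the action is the double cover of
  SO(3).\<close>

lemma rho_SU2:
  assumes "U \<in> SU 2"
  shows "\<exists>R. real_orthogonal 3 R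
    \<and> (\<forall>z. \<forall>i<3. rho 2 2 (Lact (G_SU2 U) z) i = (\<Sum>j<3. R i j * rho 2 2 z j))"
proof -
  \<comment> \<open>The half and the conjugates become independent variables. All claims are then
    polynomial identities modulo \<open>2 * h = 1\<close>, \<open>\<i> * \<i> = - 1\<close> and
    \<open>a * a' + b * b' = 1\<close>, and conjugation merely swaps letters.\<close>
  define h :: complex where "h = 1/2"
  have h: "2 * h = 1" and i: "\<i> * \<i> = - 1" by (simp_all add: h_def)
  define a b a' b' where ab: "a = U 0 0" "b = U 0 1" "a' = cnj a" "b' = cnj b"
  have U: "U 0 0 = a" "U 0 1 = b" "U 1 0 = - b'" "U 1 1 = a'" and 1: "a * a' + b * b' = 1"
    using SU_2[OF assms] by (simp_all add: ab)
  have cnj: "cnj a = a'" "cnj b = b'" "cnj a' = a" "cnj b' = b" "cnj h = h"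
    by (simp_all add: ab h_def)
  \<comment> \<open>Obtained by expanding \<open>rho 2 2\<close> at the transformed vector and
    substituting \<open>(z 0)^2 = - rho 2 2 z 0 - \<i> * rho 2 2 z 1\<close>,
    \<open>(z 1)^2 = rho 2 2 z 0 - \<i> * rho 2 2 z 1\<close> and
    \<open>z 0 * z 1 = rho 2 2 z 2\<close>.\<close>
  define R :: cmat where "R = (\<lambda>i j.
    [[h * (a^2 + a'^2 - b^2 - b'^2), \<i> * (h * (a^2 - a'^2 + b^2 - b'^2)), - (a * b + a' * b')],
     [\<i> * (h * (a'^2 - a^2 + b^2 - b'^2)), h * (a^2 + a'^2 + b^2 + b'^2), \<i> * (a * b - a' * b')],
     [a * b' + a' * b, \<i> * (a * b' - a' * b), a * a' - b * b']] ! i ! j)"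
  have R:
    "R 0 0 = h * (a^2 + a'^2 - b^2 - b'^2)" "R 0 1 = \<i> * (h * (a^2 - a'^2 + b^2 - b'^2))"
    "R 0 2 = - (a * b + a' * b')"
    "R 1 0 = \<i> * (h * (a'^2 - a^2 + b^2 - b'^2))" "R 1 1 = h * (a^2 + a'^2 + b^2 + b'^2)"
    "R 1 2 = \<i> * (a * b - a' * b')"
    "R 2 0 = a * b' + a' * b" "R 2 1 = \<i> * (a * b' - a' * b)" "R 2 2 = a * a' - b * b'"
    by (simp_all add: R_def)
  have "real_orthogonal 3 R"
    unfolding real_orthogonal_def less_numeral_cases sum_lessThan_numeral
    apply (intro allI impI conjI; elim disjE; hypsubst; unfold R complex_cnj_add complex_cnj_diff
        complex_cnj_mult complex_cnj_minus complex_cnj_power complex_cnj_i cnj)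
    apply (use h i 1 in \<open>(simp; fail) | (simp, algebra) | algebra\<close>)+
    done
  moreover have "\<forall>z. \<forall>i<3. rho 2 2 (Lact (G_SU2 U) z) i = (\<Sum>j<3. R i j * rho 2 2 z j)"
  proof -
    have L: "Lact (G_SU2 U) z 0 = a * z 0 + b * z 1" "Lact (G_SU2 U) z 1 = - b' * z 0 + a' * z 1" for z
      using U by (simp_all add: sum_lessThan_numeral)
    show ?thesis
      unfolding less_numeral_cases sum_lessThan_numeral
      apply (intro allI impI; elim disjE; hypsubst; unfold R rho_2 L h_def[symmetric])
      subgoal using h i by algebra
      subgoal using h i by algebra
      subgoal using h i by algebra
      done
  qed
  ultimately show ?thesis by blast
qed

lemma rho_3:
  "rho 3 4 z 0 = z 0 * z 2 + z 1 * z 3"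
  "rho 3 4 z 1 = \<i> * (z 0 * z 2 - z 1 * z 3)"
  "rho 3 4 z 2 = \<i> * (z 0 * z 3 + z 1 * z 2)"
  "rho 3 4 z 3 = z 0 * z 3 - z 1 * z 2"
  by (simp_all add: rho_def)

text \<open>The components of \<open>rho 3 4\<close> form a basis of the span of the products of one
  of \<open>z 0\<close>, \<open>z 1\<close> with one of \<open>z 2\<close>, \<open>z 3\<close>. The
  group thus acts as on a tensor product of two planes, and in this basis the action is the double
  cover of SO(4). The entries of \<open>R\<close> come from solving for the four products.\<close>

lemma rho_SU2xSU2:
  assumes "V \<in> SU 2" and "W \<in> SU 2"
  shows "\<exists>R. real_orthogonal 4 R
    \<and> (\<forall>z. \<forall>i<4. rho 3 4 (Lact (G_SU2xSU2 V W) z) i = (\<Sum>j<4. R i j * rho 3 4 z j))"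
proof -
  define h :: complex where "h = 1/2"
  have h: "2 * h = 1" and i: "\<i> * \<i> = - 1" by (simp_all add: h_def)
  define a b a' b' where ab: "a = V 0 0" "b = V 0 1" "a' = cnj a" "b' = cnj b"
  define c d c' d' where cd: "c = W 0 0" "d = W 0 1" "c' = cnj c" "d' = cnj d"
  have V: "V 0 0 = a" "V 0 1 = b" "V 1 0 = - b'" "V 1 1 = a'" and 1: "a * a' + b * b' = 1"
    using SU_2[OF assms(1)] by (simp_all add: ab)
  have W: "W 0 0 = c" "W 0 1 = d" "W 1 0 = - d'" "W 1 1 = c'" and 2: "c * c' + d * d' = 1"
    using SU_2[OF assms(2)] by (simp_all add: cd)
  have cnj: "cnj a = a'" "cnj b = b'" "cnj a' = a" "cnj b' = b"
     "cnj c = c'" "cnj d = d'" "cnj c' = c" "cnj d' = d" "cnj h = h"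
    by (simp_all add: ab cd h_def)
  define R :: cmat where "R = (\<lambda>i j.
    [[h * (a*c + a'*c' + b*d + b'*d'), - (\<i> * (h * (a*c - a'*c' - b*d + b'*d'))),
      - (\<i> * (h * (a*d - a'*d' + b*c - b'*c'))), h * (a*d + a'*d' - b*c - b'*c')],
     [\<i> * (h * (a*c - a'*c' + b*d - b'*d')), h * (a*c + a'*c' - b*d - b'*d'),
      h * (a*d + a'*d' + b*c + b'*c'), \<i> * (h * (a*d - a'*d' - b*c + b'*c'))],
     [- (\<i> * (h * (a*d' - a'*d - b*c' + b'*c))), - (h * (a*d' + a'*d + b*c' + b'*c)),
      h * (a*c' + a'*c - b*d' - b'*d), \<i> * (h * (a*c' - a'*c + b*d' - b'*d))],
     [- (h * (a*d' + a'*d - b*c' - b'*c)), \<i> * (h * (a*d' - a'*d + b*c' - b'*c)),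
      - (\<i> * (h * (a*c' - a'*c - b*d' + b'*d))), h * (a*c' + a'*c + b*d' + b'*d)]] ! i ! j)"
  have R:
    "R 0 0 = h * (a*c + a'*c' + b*d + b'*d')" "R 0 1 = - (\<i> * (h * (a*c - a'*c' - b*d + b'*d')))"
    "R 0 2 = - (\<i> * (h * (a*d - a'*d' + b*c - b'*c')))" "R 0 3 = h * (a*d + a'*d' - b*c - b'*c')"
    "R 1 0 = \<i> * (h * (a*c - a'*c' + b*d - b'*d'))" "R 1 1 = h * (a*c + a'*c' - b*d - b'*d')"
    "R 1 2 = h * (a*d + a'*d' + b*c + b'*c')" "R 1 3 = \<i> * (h * (a*d - a'*d' - b*c + b'*c'))"
    "R 2 0 = - (\<i> * (h * (a*d' - a'*d - b*c' + b'*c)))" "R 2 1 = - (h * (a*d' + a'*d + b*c' + b'*c))"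
    "R 2 2 = h * (a*c' + a'*c - b*d' - b'*d)" "R 2 3 = \<i> * (h * (a*c' - a'*c + b*d' - b'*d))"
    "R 3 0 = - (h * (a*d' + a'*d - b*c' - b'*c))" "R 3 1 = \<i> * (h * (a*d' - a'*d + b*c' - b'*c))"
    "R 3 2 = - (\<i> * (h * (a*c' - a'*c - b*d' + b'*d)))" "R 3 3 = h * (a*c' + a'*c + b*d' + b'*d)"
    by (simp_all add: R_def)
  have real: "cnj (R i j) = R i j" if "i < 4" "j < 4" for i j
    using that unfolding less_numeral_cases
    by (elim disjE; hypsubst) (simp_all add: R cnj algebra_simps del: One_nat_def)
  have row: "\<forall>i<4. \<forall>j<4. (\<Sum>l<4. R i l * R j l) = (if i = j then 1 else 0)"
    unfolding less_numeral_cases sum_lessThan_numeral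
    apply (intro allI impI; elim disjE; hypsubst; unfold R)
    apply (((rule eq_if_TrueI, (simp; fail)) | (rule eq_if_FalseI, (simp; fail))),
        use h i 1 2 in \<open>(simp add: algebra_simps; fail) | algebra\<close>)+
    done
  have col: "\<forall>i<4. \<forall>j<4. (\<Sum>l<4. R l i * R l j) = (if i = j then 1 else 0)"
    unfolding less_numeral_cases sum_lessThan_numeral
    apply (intro allI impI; elim disjE; hypsubst; unfold R)
    apply (((rule eq_if_TrueI, (simp; fail)) | (rule eq_if_FalseI, (simp; fail))),
        use h i 1 2 in \<open>(simp add: algebra_simps; fail) | algebra\<close>)+
    done
  have "real_orthogonal 4 R"
    using real row col by (simp add: real_orthogonal_def)
  moreover have "\<forall>z. \<forall>i<4. rho 3 4 (Lact (G_SU2xSU2 V W) z) i = (\<Sum>j<4. R i j * rho 3 4 z j)"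
  proof -
    have L: "Lact (G_SU2xSU2 V W) z 0 = a * z 0 + b * z 1" "Lact (G_SU2xSU2 V W) z 1 = - b' * z 0 + a' * z 1"
       "Lact (G_SU2xSU2 V W) z 2 = c * z 2 + d * z 3" "Lact (G_SU2xSU2 V W) z 3 = - d' * z 2 + c' * z 3" for z
      using V W by (simp_all add: sum_lessThan_numeral numeral_2_eq_2 numeral_3_eq_3)
    show ?thesis
      unfolding less_numeral_cases sum_lessThan_numeral
      apply (intro allI impI; elim disjE; hypsubst; unfold R rho_3 L)
      subgoal using h i by algebra
      subgoal using h i by algebra
      subgoal using h i by algebra
      subgoal using h i by algebra
      done
  qed
  ultimately show ?thesis by blast
qed

text \<open>The Pluecker index \<open>I < 6\<close> stands for the pair \<open>pfst I < psnd I\<close> of elements of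
  \<open>{0..3}\<close>; complementary pairs are \<open>I\<close> and \<open>5 - I\<close>, and \<open>psgn I\<close> is the sign of the
  permutation listing the pair followed by its complement.\<close>

definition pfst :: "nat \<Rightarrow> nat" where "pfst I = [0, 0, 0, 1, 1, 2] ! I"
definition psnd :: "nat \<Rightarrow> nat" where "psnd I = [1, 2, 3, 2, 3, 3] ! I"
definition psgn :: "nat \<Rightarrow> complex" where "psgn I = [1, -1, 1, 1, -1, 1] ! I"

definition wedge :: "cvec \<Rightarrow> cvec \<Rightarrow> cvec" where
  "wedge a b I = a (pfst I) * b (psnd I) - a (psnd I) * b (pfst I)"

lemma pidx:
  "pfst 0 = 0" "pfst 1 = 0" "pfst 2 = 0" "pfst 3 = 1" "pfst 4 = 1" "pfst 5 = 2"
  "psnd 0 = 1" "psnd 1 = 2" "psnd 2 = 3" "psnd 3 = 2" "psnd 4 = 3" "psnd 5 = 3"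
  "psgn 0 = 1" "psgn 1 = -1" "psgn 2 = 1" "psgn 3 = 1" "psgn 4 = -1" "psgn 5 = 1"
  by (simp_all add: pfst_def psnd_def psgn_def)

text \<open>The Cauchy-Binet formula for minors of order two.\<close>

lemma sum_wedge_mult:
  "(\<Sum>I<6. wedge a b I * wedge c d I)
     = (\<Sum>l<4. a l * c l) * (\<Sum>l<4. b l * d l) - (\<Sum>l<4. a l * d l) * (\<Sum>l<4. b l * c l)"
  unfolding sum_lessThan_numeral wedge_def pidx by algebra

text \<open>Laplace expansion of the determinant along its first two rows.\<close>

lemma sum_wedge_complement:
  "(\<Sum>I<6. psgn I * wedge a b I * wedge c d (5 - I)) = mdet 4 (\<lambda>i. [a, b, c, d] ! i)"
proof -
  have 1: "5 - 1 = (4::nat)" "5 - 2 = (3::nat)" "5 - 3 = (2::nat)" "5 - 4 = (1::nat)" "5 - 5 = (0::nat)" "5 - 0 = (5::nat)"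
    by simp_all
  have 2: "[a, b, c, d] ! 0 = a" "[a, b, c, d] ! 1 = b" "[a, b, c, d] ! 2 = c" "[a, b, c, d] ! 3 = d"
    by simp_all
  show ?thesis
    unfolding sum_lessThan_numeral wedge_def 1 pidx mdet_4 2 by algebra
qed

text \<open>The second compound matrix: the minors of order two of \<open>U\<close>, that is, the
  matrix of its second exterior power in Pluecker coordinates.\<close>

definition compound :: "cmat \<Rightarrow> cmat" where
  "compound U I J = wedge (U (pfst I)) (U (psnd I)) J"

lemma compound_eq_wedge_columns:
  "compound U I J = wedge (\<lambda>l. U l (pfst J)) (\<lambda>l. U l (psnd J)) I"
  by (simp add: compound_def wedge_def algebra_simps)

lemma wedge_compound:
  "wedge (\<lambda>i. \<Sum>j<4. U i j * z j) (\<lambda>i. \<Sum>j<4. U i j * w j) I = (\<Sum>J<6. compound U I J * wedge z w J)"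
  unfolding compound_def sum_wedge_mult by (simp add: wedge_def mult.commute)

text \<open>By Cauchy-Binet, inner products of columns of the compound matrix are minors of the Gram
  matrix of the columns of \<open>U\<close>, which is the identity.\<close>

lemma compound_column:
  assumes "scaled_unitary 4 1 U"
  shows "scaled_unitary 6 1 (compound U)"
proof -
  have u: "(\<Sum>l<4. cnj (U l i) * U l j) = (if i = j then 1 else 0)" if "i < 4" "j < 4" for i j
    using assms that by (rule scaled_unitaryD)
  have c: "cnj (compound U I J) = wedge (\<lambda>l. cnj (U l (pfst J))) (\<lambda>l. cnj (U l (psnd J))) I" for I J
    by (simp add: compound_eq_wedge_columns wedge_def)
  have e: "(\<Sum>I<6. cnj (compound U I J) * compound U I K)
     = (\<Sum>l<4. cnj (U l (pfst J)) * U l (pfst K)) * (\<Sum>l<4. cnj (U l (psnd J)) * U l (psnd K))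
     - (\<Sum>l<4. cnj (U l (pfst J)) * U l (psnd K)) * (\<Sum>l<4. cnj (U l (psnd J)) * U l (pfst K))" for J K
    unfolding c by (simp add: compound_eq_wedge_columns sum_wedge_mult)
  show ?thesis
    unfolding scaled_unitary_def
  proof (intro allI impI)
    fix J K :: nat assume "J < 6" "K < 6"
    then show "(\<Sum>I<6. cnj (compound U I J) * compound U I K) = (if J = K then 1 else 0)"
      unfolding e less_numeral_cases
      by (elim disjE; hypsubst; unfold pidx) (simp_all add: u del: One_nat_def)
  qed
qed

text \<open>By Laplace expansion the sum is the determinant of the rows of \<open>U\<close> listed
  by the pairs \<open>I\<close> and \<open>L\<close>. Unless the pairs are complementary a row is
  repeated; if they are, the rows are permuted with sign \<open>psgn I\<close>.\<close>

lemma compound_complement: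
  assumes "mdet 4 U = 1" and "I < 6" and "L < 6"
  shows "(\<Sum>K<6. psgn K * compound U I K * compound U L (5 - K)) = (if L = 5 - I then psgn I else 0)"
proof -
  have 1: "5 - 1 = (4::nat)" "5 - 2 = (3::nat)" "5 - 3 = (2::nat)" "5 - 4 = (1::nat)" "5 - 5 = (0::nat)" "5 - 0 = (5::nat)"
    by simp_all
  have 2: "[a, b, c, d] ! 0 = a" "[a, b, c, d] ! 1 = b" "[a, b, c, d] ! 2 = c" "[a, b, c, d] ! 3 = d"
    for a b c d :: "'a"
    by simp_all
  note d = assms(1)[unfolded mdet_4]
  have "\<forall>I<6. \<forall>L<6. mdet 4 (\<lambda>i. [U (pfst I), U (psnd I), U (pfst L), U (psnd L)] ! i)
      = (if L = 5 - I then psgn I else 0)"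
    unfolding less_numeral_cases mdet_4 2
    apply (intro allI impI; elim disjE; hypsubst; unfold pidx 1)
    apply (((rule eq_if_TrueI, (simp; fail)) | (rule eq_if_FalseI, (simp; fail))),
        use d in \<open>(simp add: algebra_simps; fail) | algebra\<close>)+
    done
  with assms(2,3) show ?thesis
    unfolding compound_def sum_wedge_complement by blast
qed

lemma psgn_sq [simp]: "I < 6 \<Longrightarrow> psgn I * psgn I = 1"
  unfolding less_numeral_cases by (elim disjE) (simp_all add: psgn_def)

lemma cnj_psgn [simp]: "I < 6 \<Longrightarrow> cnj (psgn I) = psgn I"
  unfolding less_numeral_cases by (elim disjE) (simp_all add: psgn_def)

text \<open>Jacobi's complementary minor identity: compare unitarity of the compound matrix with the
  Laplace expansion.\<close>
lemma cnj_compound: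
  assumes U: "U \<in> SU 4" and IJ: "I < 6" "J < 6"
  shows "cnj (compound U I J) = psgn I * psgn J * compound U (5 - I) (5 - J)"
proof -
  let ?M = "compound U"
  have col: "(\<Sum>K<6. cnj (?M K J) * ?M K L) = (if J = L then 1 else 0)" if "L < 6" for L
    using compound_column[OF SU_scaled_unitary[OF U]] IJ(2) that by (rule scaled_unitaryD)
  have compl: "(\<Sum>L<6. psgn L * ?M K L * ?M (5 - I) (5 - L)) = (if 5 - I = 5 - K then psgn K else 0)"
    if "K < 6" for K
    using U that by (intro compound_complement) (auto simp: SU_def)
  have "psgn J * ?M (5 - I) (5 - J) = (\<Sum>L<6. if J = L then psgn L * ?M (5 - I) (5 - L) else 0)"
    using IJ by simp
  also have "\<dots> = (\<Sum>L<6. psgn L * ?M (5 - I) (5 - L) * (\<Sum>K<6. cnj (?M K J) * ?M K L))"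
    by (intro sum.cong) (simp_all add: col)
  also have "\<dots> = (\<Sum>K<6. cnj (?M K J) * (\<Sum>L<6. psgn L * ?M K L * ?M (5 - I) (5 - L)))"
    unfolding sum_distrib_left by (subst sum.swap) (intro sum.cong refl, simp add: mult_ac)
  also have "\<dots> = (\<Sum>K<6. if I = K then cnj (?M K J) * psgn K else 0)"
    using IJ(1) by (intro sum.cong) (auto simp: compl)
  also have "\<dots> = cnj (?M I J) * psgn I"
    using IJ by simp
  finally have "psgn I * (psgn J * ?M (5 - I) (5 - J)) = psgn I * psgn I * cnj (?M I J)"
    by (simp add: mult_ac)
  then show ?thesis using IJ by (simp add: mult_ac)
qed

text \<open>Jacobi's identity replaces the conjugated minors by complementary ones, which turns the
  sum into a Laplace expansion.\<close>

lemma compound_row: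
  assumes U: "U \<in> SU 4"
  shows "scaled_unitary 6 1 (\<lambda>i j. compound U j i)"
  unfolding scaled_unitary_def
proof (intro allI impI)
  fix I J :: nat assume IJ: "I < 6" "J < 6"
  have "(\<Sum>L<6. cnj (compound U I L) * compound U J L)
     = psgn I * (\<Sum>L<6. psgn L * compound U J L * compound U (5 - I) (5 - L))"
    unfolding sum_distrib_left using IJ
    by (intro sum.cong refl) (simp add: cnj_compound[OF U] mult_ac)
  also have "\<dots> = psgn I * (if 5 - I = 5 - J then psgn J else 0)"
    using U IJ by (subst compound_complement) (auto simp: SU_def)
  also have "\<dots> = (if I = J then 1 else 0)"
    using IJ by auto
  finally show "(\<Sum>L<6. cnj (compound U I L) * compound U J L) = (if I = J then 1 else 0)" .
qed

text \<open>\<open>rho 5 8 z\<close> is \<open>rho_mat\<close> applied to the Pluecker coordinates of the first half of \<open>z\<close>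
  and \<open>Emat\<close> times its second half.\<close>
definition rho_mat :: cmat where
  "rho_mat a I = [[0, 0, -\<i>, -\<i>, 0, 0], [0, 0, 1, -1, 0, 0], [0, 1, 0, 0, 1, 0],
     [0, \<i>, 0, 0, -\<i>, 0], [-\<i>, 0, 0, 0, 0, -\<i>], [1, 0, 0, 0, 0, -1]] ! a ! I"

text \<open>The conjugate transpose divided by 2, because the columns of \<open>rho_mat\<close> are
  orthogonal with squared length 2.\<close>

definition rho_mat_inv :: cmat where
  "rho_mat_inv I a = cnj (rho_mat a I) / 2"

lemma rho_mat_entries:
  "rho_mat 0 0 = 0" "rho_mat 0 1 = 0" "rho_mat 0 2 = -\<i>" "rho_mat 0 3 = -\<i>" "rho_mat 0 4 = 0" "rho_mat 0 5 = 0"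
  "rho_mat 1 0 = 0" "rho_mat 1 1 = 0" "rho_mat 1 2 = 1" "rho_mat 1 3 = -1" "rho_mat 1 4 = 0" "rho_mat 1 5 = 0"
  "rho_mat 2 0 = 0" "rho_mat 2 1 = 1" "rho_mat 2 2 = 0" "rho_mat 2 3 = 0" "rho_mat 2 4 = 1" "rho_mat 2 5 = 0"
  "rho_mat 3 0 = 0" "rho_mat 3 1 = \<i>" "rho_mat 3 2 = 0" "rho_mat 3 3 = 0" "rho_mat 3 4 = -\<i>" "rho_mat 3 5 = 0"
  "rho_mat 4 0 = -\<i>" "rho_mat 4 1 = 0" "rho_mat 4 2 = 0" "rho_mat 4 3 = 0" "rho_mat 4 4 = 0" "rho_mat 4 5 = -\<i>"
  "rho_mat 5 0 = 1" "rho_mat 5 1 = 0" "rho_mat 5 2 = 0" "rho_mat 5 3 = 0" "rho_mat 5 4 = 0" "rho_mat 5 5 = -1"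
  by (simp_all add: rho_mat_def)

lemma rho_mat_column: "scaled_unitary 6 2 rho_mat"
  unfolding scaled_unitary_def less_numeral_cases sum_lessThan_numeral
  by (intro allI impI; elim disjE; hypsubst; unfold rho_mat_entries; simp)

lemma rho_mat_row: "scaled_unitary 6 2 (\<lambda>i j. rho_mat j i)"
  unfolding scaled_unitary_def less_numeral_cases sum_lessThan_numeral
  by (intro allI impI; elim disjE; hypsubst; unfold rho_mat_entries; simp)

lemma rho_mat_inv_column: "scaled_unitary 6 (1/2) rho_mat_inv"
  unfolding scaled_unitary_def rho_mat_inv_def less_numeral_cases sum_lessThan_numeral
  by (intro allI impI; elim disjE; hypsubst; unfold rho_mat_entries; simp)

lemma rho_mat_inv_row: "scaled_unitary 6 (1/2) (\<lambda>i j. rho_mat_inv j i)"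
  unfolding scaled_unitary_def rho_mat_inv_def less_numeral_cases sum_lessThan_numeral
  by (intro allI impI; elim disjE; hypsubst; unfold rho_mat_entries; simp)

lemma rho_mat_inv_mult:
  assumes "I < 6" "J < 6"
  shows "(\<Sum>b<6. rho_mat_inv I b * rho_mat b J) = (if I = J then 1 else 0)"
proof -
  have "(\<Sum>b<6. rho_mat_inv I b * rho_mat b J) = (\<Sum>b<6. cnj (rho_mat b I) * rho_mat b J) / 2"
    by (simp add: rho_mat_inv_def sum_divide_distrib)
  also have "\<dots> = (if I = J then 1 else 0)"
    unfolding scaled_unitaryD[OF rho_mat_column assms] by simp
  finally show ?thesis .
qed

text \<open>Up to an overall sign this is the symmetry of \<open>cnj_compound\<close>: passing to
  complementary pairs, the Hodge star, corresponds to complex conjugation. The overall sign cancels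
  against that of the inverse matrix.\<close>

lemma cnj_rho_mat:
  assumes "a < 6" "I < 6"
  shows "cnj (rho_mat a I) = - psgn I * rho_mat a (5 - I)"
proof -
  have 1: "5 - 1 = (4::nat)" "5 - 2 = (3::nat)" "5 - 3 = (2::nat)" "5 - 4 = (1::nat)" "5 - 5 = (0::nat)" "5 - 0 = (5::nat)"
    by simp_all
  have "\<forall>a<6. \<forall>I<6. cnj (rho_mat a I) = - psgn I * rho_mat a (5 - I)"
    unfolding less_numeral_cases
    by (intro allI impI; elim disjE; hypsubst; unfold 1 rho_mat_entries pidx; simp)
  with assms show ?thesis by blast
qed

lemma cnj_rho_mat_inv:
  assumes "a < 6" "I < 6"
  shows "cnj (rho_mat_inv I a) = - psgn I * rho_mat_inv (5 - I) a"
  using assms cnj_rho_mat[of a "5 - I"] cnj_rho_mat[OF assms]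
  by (simp add: rho_mat_inv_def)

lemma rho_5:
  assumes "a < 6"
  shows "rho 5 8 z a = (\<Sum>I<6. rho_mat a I * wedge z (\<lambda>i. \<Sum>j<4. Emat i j * z (j + 4)) I)"
  using assms unfolding less_numeral_cases
  apply (elim disjE; hypsubst)
  apply (simp_all add: rho_def sum_lessThan_numeral wedge_def pidx rho_mat_def Emat_def One_nat_def[symmetric] algebra_simps
      del: One_nat_def)
  done

lemma mmul_apply: "(\<Sum>j<k. mmul k A B i j * x j) = (\<Sum>l<k. A i l * (\<Sum>j<k. B l j * x j))"
  unfolding mmul_def sum_distrib_left sum_distrib_right
  by (subst sum.swap) (simp add: mult_ac)

lemma Emat_Emat:
  assumes "i < 4"
  shows "(\<Sum>j<4. Emat i j * (\<Sum>l<4. Emat j l * x l)) = x i"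
  using assms unfolding less_numeral_cases
  by (elim disjE; simp add: sum_lessThan_numeral Emat_def)

text \<open>Since \<open>Emat\<close> is an involution, \<open>Emat\<close> times the second half of
  the vector is transformed by \<open>U\<close> itself. Hence both factors of the wedge product
  transform in the same way.\<close>

lemma Emat_EUE:
  assumes "i < 4"
  shows "(\<Sum>j<4. Emat i j * Lact (G_SU4 U) z (j + 4)) = (\<Sum>j<4. U i j * (\<Sum>l<4. Emat j l * z (l + 4)))"
proof -
  have "(\<Sum>j<4. Emat i j * Lact (G_SU4 U) z (j + 4))
    = (\<Sum>j<4. Emat i j * (\<Sum>l<4. mmul 4 (mmul 4 Emat U) Emat j l * z (l + 4)))"
    by (simp add: Let_def)
  then show ?thesis
    by (simp only: mmul_apply Emat_Emat[OF assms])
qed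

text \<open>The matrix is the second exterior power of \<open>U\<close> written in the coordinates
  \<open>rho_mat\<close>, where the conjugation commuting with SU(4) is the ordinary one; this is
  the double cover of SO(6).\<close>

lemma rho_SU4:
  assumes U: "U \<in> SU 4"
  shows "\<exists>R. real_orthogonal 6 R
    \<and> (\<forall>z. \<forall>i<6. rho 5 8 (Lact (G_SU4 U) z) i = (\<Sum>j<6. R i j * rho 5 8 z j))"
proof -
  let ?M = "compound U"
  define R where "R = mmul 6 (mmul 6 rho_mat ?M) rho_mat_inv"
  have R: "R i j = (\<Sum>I<6. \<Sum>J<6. rho_mat i I * ?M I J * rho_mat_inv J j)" for i j
    unfolding R_def mmul_def sum_distrib_right by (rule sum.swap)
  have real: "cnj (R i j) = R i j" if "i < 6" "j < 6" for i j
  proof -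
    \<comment> \<open>Conjugation replaces every factor by its complementary one. Each sign occurs
      twice and disappears, and reversing both summations then restores the original sum.\<close>
    have "cnj (R i j) = (\<Sum>I<6. \<Sum>J<6. rho_mat i (5 - I) * ?M (5 - I) (5 - J) * rho_mat_inv (5 - J) j)"
      unfolding R cnj_sum
    proof (intro sum.cong refl)
      fix I J :: nat assume "I \<in> {..<6}" "J \<in> {..<6}"
      then have IJ: "I < 6" "J < 6" by auto
      have "cnj (rho_mat i I * ?M I J * rho_mat_inv J j)
        = (psgn I * psgn I) * (psgn J * psgn J) * (rho_mat i (5 - I) * ?M (5 - I) (5 - J) * rho_mat_inv (5 - J) j)"
        using that IJ by (simp add: cnj_compound[OF U] cnj_rho_mat cnj_rho_mat_inv mult_ac del: psgn_sq)
      then show "cnj (rho_mat i I * ?M I J * rho_mat_inv J j)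
        = rho_mat i (5 - I) * ?M (5 - I) (5 - J) * rho_mat_inv (5 - J) j"
        using IJ by simp
    qed
    also have "\<dots> = R i j"
    proof -
      have *: "(\<Sum>I<6. f (5 - I)) = (\<Sum>I<6. f I)" for f :: "nat \<Rightarrow> complex"
        using sum.nat_diff_reindex[of f 6] by simp
      have "(\<Sum>I<6. \<Sum>J<6. rho_mat i (5 - I) * ?M (5 - I) (5 - J) * rho_mat_inv (5 - J) j)
          = (\<Sum>I<6. \<Sum>J<6. rho_mat i (5 - I) * ?M (5 - I) J * rho_mat_inv J j)"
      proof (rule sum.cong[OF refl])
        fix I
        show "(\<Sum>J<6. rho_mat i (5 - I) * ?M (5 - I) (5 - J) * rho_mat_inv (5 - J) j)
          = (\<Sum>J<6. rho_mat i (5 - I) * ?M (5 - I) J * rho_mat_inv J j)"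
          by (rule *[of "\<lambda>J. rho_mat i (5 - I) * ?M (5 - I) J * rho_mat_inv J j"])
      qed
      also have "\<dots> = R i j"
        unfolding R by (rule *[of "\<lambda>I. \<Sum>J<6. rho_mat i I * ?M I J * rho_mat_inv J j"])
      finally show ?thesis .
    qed
    finally show ?thesis .
  qed
  have "scaled_unitary 6 (2 * 1 * (1/2)) R"
    unfolding R_def using compound_column[OF SU_scaled_unitary[OF U]]
    by (intro scaled_unitary_mmul rho_mat_column rho_mat_inv_column)
  then have col: "(\<Sum>l<6. R l i * R l j) = (if i = j then 1 else 0)" if "i < 6" "j < 6" for i j
    using that by (simp add: scaled_unitary_def real)
  have "scaled_unitary 6 (1/2 * (1 * 2)) (\<lambda>i j. R j i)"
    unfolding R_def mmul_transpose using compound_row[OF U]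
    by (intro scaled_unitary_mmul rho_mat_row rho_mat_inv_row)
  then have row: "(\<Sum>l<6. R i l * R j l) = (if i = j then 1 else 0)" if "i < 6" "j < 6" for i j
    using that by (simp add: scaled_unitary_def real)
  have "real_orthogonal 6 R"
    using real row col by (simp add: real_orthogonal_def)
  moreover have "rho 5 8 (Lact (G_SU4 U) z) i = (\<Sum>j<6. R i j * rho 5 8 z j)" if i: "i < 6" for z i
  proof -
    define w where "w = (\<lambda>i. \<Sum>j<4. Emat i j * z (j + 4))"
    have p: "pfst I < 4" "psnd I < 4" if "I < 6" for I
      using that unfolding less_numeral_cases(3) by (elim disjE; simp add: pidx[simplified])+
    \<comment> \<open>The Pluecker coordinates are recovered from \<open>rho 5 8 z\<close>, so that
      their transformation law can be expressed through \<open>rho\<close> alone.\<close>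
    have inv: "(\<Sum>j<6. rho_mat_inv J j * rho 5 8 z j) = wedge z w J" if "J < 6" for J
    proof -
      have "(\<Sum>j<6. rho_mat_inv J j * rho 5 8 z j) = (\<Sum>j<6. \<Sum>I<6. wedge z w I * (rho_mat_inv J j * rho_mat j I))"
        by (intro sum.cong refl) (simp add: rho_5 w_def sum_distrib_left mult_ac)
      also have "\<dots> = (\<Sum>I<6. wedge z w I * (\<Sum>j<6. rho_mat_inv J j * rho_mat j I))"
        by (subst sum.swap) (simp add: sum_distrib_left)
      also have "\<dots> = (\<Sum>I<6. if J = I then wedge z w I else 0)"
        using that by (intro sum.cong refl) (simp add: rho_mat_inv_mult)
      finally show ?thesis using that by simp
    qed
    have "rho 5 8 (Lact (G_SU4 U) z) i
      = (\<Sum>I<6. rho_mat i I * wedge (\<lambda>i. \<Sum>j<4. U i j * z j) (\<lambda>i. \<Sum>j<4. U i j * w j) I)"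
      unfolding rho_5[OF i]
    proof (intro sum.cong refl arg_cong2[of _ _ _ _ "(*)"])
      fix I :: nat assume "I \<in> {..<6}"
      then have I: "pfst I < 4" "psnd I < 4" using p by auto
      then show "wedge (Lact (G_SU4 U) z) (\<lambda>i. \<Sum>j<4. Emat i j * Lact (G_SU4 U) z (j + 4)) I
        = wedge (\<lambda>i. \<Sum>j<4. U i j * z j) (\<lambda>i. \<Sum>j<4. U i j * w j) I"
        unfolding wedge_def Emat_EUE[OF I(1)] Emat_EUE[OF I(2)] w_def by simp
    qed
    also have "\<dots> = (\<Sum>I<6. \<Sum>J<6. rho_mat i I * ?M I J * (\<Sum>j<6. rho_mat_inv J j * rho 5 8 z j))"
      unfolding wedge_compound by (intro sum.cong refl) (simp add: inv sum_distrib_left mult_ac)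
    also have "\<dots> = (\<Sum>I<6. \<Sum>j<6. \<Sum>J<6. rho_mat i I * ?M I J * rho_mat_inv J j * rho 5 8 z j)"
      unfolding sum_distrib_left
      by (rule sum.cong[OF refl], subst sum.swap, intro sum.cong refl, simp add: mult_ac)
    also have "\<dots> = (\<Sum>j<6. R i j * rho 5 8 z j)"
      unfolding R sum_distrib_right by (rule sum.swap)
    finally show ?thesis .
  qed
  ultimately show ?thesis by blast
qed

lemma rho_Lact:
  assumes "(n, m) \<in> {(2, 2), (3, 4), (5, 8)}" and "g \<in> Fgrp m"
  shows "\<exists>R. real_orthogonal (Suc n) R
    \<and> (\<forall>z. \<forall>i<Suc n. rho n m (Lact g z) i = (\<Sum>j<Suc n. R i j * rho n m z j))"
proof -
  have S: "Suc 2 = 3" "Suc 3 = 4" "Suc 5 = 6" by simp_all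
  from assms(1) consider "n = 2" "m = 2" | "n = 3" "m = 4" | "n = 5" "m = 8" by auto
  then show ?thesis
  proof cases
    case 1
    with assms(2) obtain U where "U \<in> SU 2" "g = G_SU2 U" by (auto simp: Fgrp_def)
    with rho_SU2 show ?thesis unfolding 1 S by blast
  next
    case 2
    with assms(2) obtain V W where "V \<in> SU 2" "W \<in> SU 2" "g = G_SU2xSU2 V W" by (auto simp: Fgrp_def)
    with rho_SU2xSU2 show ?thesis unfolding 2 S by blast
  next
    case 3
    with assms(2) obtain U where "U \<in> SU 4" "g = G_SU4 U" by (auto simp: Fgrp_def)
    with rho_SU4 show ?thesis unfolding 3 S by blast
  qed
qed

section \<open>Unitarity of the action and dependence on the first coordinates\<close>

definition block_diag :: "nat \<Rightarrow> cmat \<Rightarrow> cmat \<Rightarrow> cmat" where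
  "block_diag k A B i j =
     (if i < k \<and> j < k then A i j else if k \<le> i \<and> k \<le> j then B (i - k) (j - k) else 0)"

lemma sum_lessThan_add:
  fixes f :: "nat \<Rightarrow> 'a::comm_monoid_add"
  shows "(\<Sum>l<a + b. f l) = (\<Sum>l<a. f l) + (\<Sum>l<b. f (l + a))"
  by (induction b) (simp_all add: add_ac)

lemma scaled_unitary_block_diag:
  assumes A: "scaled_unitary k c A" and B: "scaled_unitary k c B"
  shows "scaled_unitary (k + k) c (block_diag k A B)"
  unfolding scaled_unitary_def
proof (intro allI impI)
  fix i j assume ij: "i < k + k" "j < k + k"
  show "(\<Sum>l<k + k. cnj (block_diag k A B l i) * block_diag k A B l j) = (if i = j then c else 0)"
  proof (cases "i < k \<and> j < k \<or> k \<le> i \<and> k \<le> j")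
    case True
    then show ?thesis
      using ij scaled_unitaryD[OF A, of i j] scaled_unitaryD[OF B, of "i - k" "j - k"]
      by (auto simp: sum_lessThan_add block_diag_def)
  next
    case False
    then show ?thesis
      by (auto simp: sum_lessThan_add block_diag_def)
  qed
qed

lemma block_diag_apply:
  assumes "i < k + k"
  shows "(\<Sum>j<k + k. block_diag k A B i j * z j)
    = (if i < k then \<Sum>j<k. A i j * z j else \<Sum>j<k. B (i - k) j * z (j + k))"
  using assms by (auto simp: sum_lessThan_add block_diag_def)

lemma scaled_unitary_Emat: "scaled_unitary 4 1 Emat"
  unfolding scaled_unitary_def less_numeral_cases sum_lessThan_numeral
  by (intro allI impI; elim disjE; hypsubst; simp add: Emat_def)

lemma Lact_unitary:
  assumes "g \<in> Fgrp m"
  shows "\<exists>U. scaled_unitary m 1 U \<and> (\<forall>z. \<forall>i<m. Lact g z i = (\<Sum>j<m. U i j * z j))"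
proof -
  consider "m = 2" | "m = 4" | "m = 8"
    using assms by (auto simp: Fgrp_def split: if_splits)
  then show ?thesis
  proof cases
    case 1
    with assms obtain U where U: "U \<in> SU 2" "g = G_SU2 U" by (auto simp: Fgrp_def)
    then have "\<forall>z. \<forall>i<2. Lact g z i = (\<Sum>j<2. U i j * z j)" by simp
    with SU_scaled_unitary[OF U(1)] show ?thesis unfolding 1 by blast
  next
    case 2
    with assms obtain V W where VW: "V \<in> SU 2" "W \<in> SU 2" "g = G_SU2xSU2 V W" by (auto simp: Fgrp_def)
    have "\<forall>z. \<forall>i<2 + 2. Lact g z i = (\<Sum>j<2 + 2. block_diag 2 V W i j * z j)"
    proof (intro allI impI)
      fix z and i :: nat assume i: "i < 2 + 2"
      show "Lact g z i = (\<Sum>j<2 + 2. block_diag 2 V W i j * z j)"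
        unfolding block_diag_apply[OF i] using VW(3) i by simp
    qed
    moreover have "scaled_unitary (2 + 2) 1 (block_diag 2 V W)"
      using VW by (intro scaled_unitary_block_diag SU_scaled_unitary)
    moreover have "m = 2 + 2" using 2 by simp
    ultimately show ?thesis by blast
  next
    case 3
    with assms obtain U where U: "U \<in> SU 4" "g = G_SU4 U" by (auto simp: Fgrp_def)
    let ?V = "mmul 4 (mmul 4 Emat U) Emat"
    have "\<forall>z. \<forall>i<4 + 4. Lact g z i = (\<Sum>j<4 + 4. block_diag 4 U ?V i j * z j)"
    proof (intro allI impI)
      fix z and i :: nat assume i: "i < 4 + 4"
      show "Lact g z i = (\<Sum>j<4 + 4. block_diag 4 U ?V i j * z j)"
        unfolding block_diag_apply[OF i] using U(2) i by (simp add: Let_def)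
    qed
    moreover have "scaled_unitary 4 (1 * 1 * 1) ?V"
      using U by (intro scaled_unitary_mmul scaled_unitary_Emat SU_scaled_unitary)
    then have "scaled_unitary (4 + 4) 1 (block_diag 4 U ?V)"
      by (intro scaled_unitary_block_diag SU_scaled_unitary[OF U(1)]) simp_all
    moreover have "m = 4 + 4" using 3 by simp
    ultimately show ?thesis by blast
  qed
qed

text \<open>Needed because the vectors compared later differ beyond coordinate \<open>m\<close>:
  \<open>Lact\<close> puts 0 there, a point of the product space has
  \<open>undefined\<close>.\<close>

lemma rho_cong:
  assumes "\<And>i. i < m \<Longrightarrow> z i = w i" and "(n, m) \<in> {(2, 2), (3, 4), (5, 8)}"
  shows "rho n m z = rho n m w"
  using assms(2)
proof (elim insertE emptyE)
  assume "(n, m) = (2, 2)"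
  then show ?thesis using assms(1) by (auto simp: rho_def fun_eq_iff)
next
  assume "(n, m) = (3, 4)"
  then show ?thesis using assms(1) by (auto simp: rho_def fun_eq_iff)
next
  assume "(n, m) = (5, 8)"
  then show ?thesis using assms(1) by (auto simp: rho_def fun_eq_iff)
qed

section \<open>Holomorphic dependence on the coherent states\<close>

lemma borel_measurable_cnj [measurable]: "cnj \<in> borel_measurable borel"
  by (intro borel_measurable_continuous_onI continuous_intros)

section \<open>Square-integrable functions on the sphere\<close>

lemma sq_int_measurable: "sq_int n \<phi> \<Longrightarrow> \<phi> \<in> borel_measurable (sphere_measure n)"
  and sq_int_integrable: "sq_int n \<phi> \<Longrightarrow> integrable (sphere_measure n) (\<lambda>x. (cmod (\<phi> x))\<^sup>2)"
  by (simp_all add: sq_int_def)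

lemma sq_int_lincomb:
  assumes "sq_int n \<phi>" and "sq_int n \<psi>"
  shows "sq_int n (\<lambda>x. a * \<phi> x + b * \<psi> x)"
proof -
  have [measurable]: "\<phi> \<in> borel_measurable (sphere_measure n)" "\<psi> \<in> borel_measurable (sphere_measure n)"
    using assms by (auto dest: sq_int_measurable)
  have "integrable (sphere_measure n) (\<lambda>x. 2 * (cmod a)\<^sup>2 * (cmod (\<phi> x))\<^sup>2 + 2 * (cmod b)\<^sup>2 * (cmod (\<psi> x))\<^sup>2)"
    using assms by (simp add: sq_int_def)
  then have "integrable (sphere_measure n) (\<lambda>x. (cmod (a * \<phi> x + b * \<psi> x))\<^sup>2)"
  proof (rule Bochner_Integration.integrable_bound)
    show "AE x in sphere_measure n. norm ((cmod (a * \<phi> x + b * \<psi> x))\<^sup>2)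
      \<le> norm (2 * (cmod a)\<^sup>2 * (cmod (\<phi> x))\<^sup>2 + 2 * (cmod b)\<^sup>2 * (cmod (\<psi> x))\<^sup>2)"
    proof (rule AE_I2)
      fix x
      have "(cmod (a * \<phi> x + b * \<psi> x))\<^sup>2 \<le> (cmod a * cmod (\<phi> x) + cmod b * cmod (\<psi> x))\<^sup>2"
        by (intro power_mono) (auto intro: order_trans[OF norm_triangle_ineq] simp: norm_mult)
      also have "\<dots> \<le> 2 * (cmod a * cmod (\<phi> x))\<^sup>2 + 2 * (cmod b * cmod (\<psi> x))\<^sup>2"
        using sum_squares_bound[of "cmod a * cmod (\<phi> x)" "cmod b * cmod (\<psi> x)"]
        by (simp add: power2_sum)
      finally show "norm ((cmod (a * \<phi> x + b * \<psi> x))\<^sup>2)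
          \<le> norm (2 * (cmod a)\<^sup>2 * (cmod (\<phi> x))\<^sup>2 + 2 * (cmod b)\<^sup>2 * (cmod (\<psi> x))\<^sup>2)"
        by (simp add: power_mult_distrib)
    qed
  qed simp
  then show ?thesis by (simp add: sq_int_def)
qed

lemma sq_int_diff: "sq_int n \<phi> \<Longrightarrow> sq_int n \<psi> \<Longrightarrow> sq_int n (\<lambda>x. \<phi> x - \<psi> x)"
  using sq_int_lincomb[of n \<phi> \<psi> 1 "-1"] by simp

lemma sq_int_zero: "sq_int n (\<lambda>x. 0)"
  by (simp add: sq_int_def)

lemma sq_int_sum:
  "finite I \<Longrightarrow> (\<And>i. i \<in> I \<Longrightarrow> sq_int n (\<phi> i)) \<Longrightarrow> sq_int n (\<lambda>x. \<Sum>i\<in>I. c i * \<phi> i x)"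
proof (induction I rule: finite_induct)
  case (insert i I)
  then show ?case
    using sq_int_lincomb[of n "\<phi> i" "\<lambda>x. \<Sum>i\<in>I. c i * \<phi> i x" "c i" 1] by simp
qed (simp add: sq_int_zero)

lemma sq_int_mult_integrable:
  assumes "sq_int n \<phi>" and "sq_int n \<psi>"
  shows "integrable (sphere_measure n) (\<lambda>x. \<phi> x * cnj (\<psi> x))"
proof -
  have [measurable]: "\<phi> \<in> borel_measurable (sphere_measure n)" "\<psi> \<in> borel_measurable (sphere_measure n)"
    using assms by (auto dest: sq_int_measurable)
  have "integrable (sphere_measure n) (\<lambda>x. (cmod (\<phi> x))\<^sup>2 + (cmod (\<psi> x))\<^sup>2)"
    using assms by (auto dest: sq_int_integrable)
  then show ?thesis
  proof (rule Bochner_Integration.integrable_bound)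
    have "cmod a * cmod b \<le> (cmod a)\<^sup>2 + (cmod b)\<^sup>2" for a b
      using sum_squares_bound[of "cmod a" "cmod b"] mult_nonneg_nonneg[OF norm_ge_zero[of a] norm_ge_zero[of b]]
      by linarith
    then show "AE x in sphere_measure n. norm (\<phi> x * cnj (\<psi> x)) \<le> norm ((cmod (\<phi> x))\<^sup>2 + (cmod (\<psi> x))\<^sup>2)"
      by (intro AE_I2) (simp add: norm_mult)
  qed simp
qed

lemma L2norm_nonneg: "0 \<le> L2norm n \<phi>"
  by (simp add: L2norm_def)

lemma sphere_inner_Cauchy_Schwarz:
  assumes "sq_int n \<phi>" and "sq_int n \<psi>"
  shows "cmod (sphere_inner n \<phi> \<psi>) \<le> L2norm n \<phi> * L2norm n \<psi>"
proof -
  let ?M = "sphere_measure n"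
  define a b where ab: "a = L2norm n \<phi>" "b = L2norm n \<psi>"
  have m [measurable]: "\<phi> \<in> borel_measurable ?M" "\<psi> \<in> borel_measurable ?M"
    using assms by (auto dest: sq_int_measurable)
  have i: "integrable ?M (\<lambda>x. (cmod (\<phi> x))\<^sup>2)" "integrable ?M (\<lambda>x. (cmod (\<psi> x))\<^sup>2)"
    using assms by (auto dest: sq_int_integrable)
  have sq: "(\<integral>x. (cmod (\<phi> x))\<^sup>2 \<partial>?M) = a\<^sup>2" "(\<integral>x. (cmod (\<psi> x))\<^sup>2 \<partial>?M) = b\<^sup>2"
    by (simp_all add: ab L2norm_def)
  have zero: "AE x in ?M. f x = 0" if "sq_int n f" "(\<integral>x. (cmod (f x))\<^sup>2 \<partial>?M) = 0" for f
    using integral_nonneg_eq_0_iff_AE[OF sq_int_integrable[OF that(1)]] that(2) by simp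
  show ?thesis
  proof (cases "a = 0 \<or> b = 0")
    case True
    then have "AE x in ?M. \<phi> x * cnj (\<psi> x) = 0"
      using zero[of \<phi>] zero[of \<psi>] assms sq by auto
    then have "sphere_inner n \<phi> \<psi> = 0"
      unfolding sphere_inner_def by (rule integral_eq_zero_AE)
    then show ?thesis by (simp add: L2norm_nonneg)
  next
    case False
    with L2norm_nonneg[of n \<phi>] L2norm_nonneg[of n \<psi>] have pos: "0 < a" "0 < b"
      by (auto simp: ab)
    have "cmod (sphere_inner n \<phi> \<psi>) \<le> (\<integral>x. cmod (\<phi> x * cnj (\<psi> x)) \<partial>?M)"
      unfolding sphere_inner_def by (rule integral_norm_bound)
    \<comment> \<open>The weights in this arithmetic-geometric mean inequality are chosen so that
      each term integrates to \<open>a * b / 2\<close>.\<close>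
    also have "\<dots> \<le> (\<integral>x. b / (2 * a) * (cmod (\<phi> x))\<^sup>2 + a / (2 * b) * (cmod (\<psi> x))\<^sup>2 \<partial>?M)"
    proof (rule integral_mono)
      show "integrable ?M (\<lambda>x. cmod (\<phi> x * cnj (\<psi> x)))"
        using sq_int_mult_integrable[OF assms] by simp
      show "integrable ?M (\<lambda>x. b / (2 * a) * (cmod (\<phi> x))\<^sup>2 + a / (2 * b) * (cmod (\<psi> x))\<^sup>2)"
        using i by simp
      fix x
      have "0 \<le> (b * cmod (\<phi> x) - a * cmod (\<psi> x))\<^sup>2 / (2 * a * b)"
        using pos by simp
      also have "\<dots> = b / (2 * a) * (cmod (\<phi> x))\<^sup>2 + a / (2 * b) * (cmod (\<psi> x))\<^sup>2 - cmod (\<phi> x) * cmod (\<psi> x)"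
        using pos by (simp add: field_simps power2_eq_square)
      finally show "cmod (\<phi> x * cnj (\<psi> x)) \<le> b / (2 * a) * (cmod (\<phi> x))\<^sup>2 + a / (2 * b) * (cmod (\<psi> x))\<^sup>2"
        by (simp add: norm_mult)
    qed
    also have "\<dots> = b / (2 * a) * a\<^sup>2 + a / (2 * b) * b\<^sup>2"
      using i by (simp add: sq)
    also have "\<dots> = a * b"
      using pos by (simp add: field_simps power2_eq_square)
    finally show ?thesis by (simp add: ab)
  qed
qed

lemma sphere_inner_diff_left:
  assumes "sq_int n \<phi>" "sq_int n \<psi>" "sq_int n \<theta>"
  shows "sphere_inner n (\<lambda>x. \<phi> x - \<psi> x) \<theta> = sphere_inner n \<phi> \<theta> - sphere_inner n \<psi> \<theta>"
  unfolding sphere_inner_def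
  using assms by (simp add: left_diff_distrib sq_int_mult_integrable)

lemma sphere_inner_diff_right:
  assumes "sq_int n \<phi>" "sq_int n \<psi>" "sq_int n \<theta>"
  shows "sphere_inner n \<theta> (\<lambda>x. \<phi> x - \<psi> x) = sphere_inner n \<theta> \<phi> - sphere_inner n \<theta> \<psi>"
  unfolding sphere_inner_def
  using assms by (simp add: right_diff_distrib sq_int_mult_integrable)

lemma sphere_inner_sum:
  assumes "\<And>i. i \<in> I \<Longrightarrow> sq_int n (\<phi> i)" and "\<And>j. j \<in> J \<Longrightarrow> sq_int n (\<psi> j)"
  shows "sphere_inner n (\<lambda>x. \<Sum>i\<in>I. c i * \<phi> i x) (\<lambda>x. \<Sum>j\<in>J. d j * \<psi> j x)
    = (\<Sum>i\<in>I. \<Sum>j\<in>J. c i * cnj (d j) * sphere_inner n (\<phi> i) (\<psi> j))"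
proof -
  have "sphere_inner n (\<lambda>x. \<Sum>i\<in>I. c i * \<phi> i x) (\<lambda>x. \<Sum>j\<in>J. d j * \<psi> j x)
    = (\<integral>x. (\<Sum>i\<in>I. \<Sum>j\<in>J. c i * cnj (d j) * (\<phi> i x * cnj (\<psi> j x))) \<partial>sphere_measure n)"
    unfolding sphere_inner_def by (simp add: sum_product mult_ac)
  also have "\<dots> = (\<Sum>i\<in>I. \<Sum>j\<in>J. c i * cnj (d j) * sphere_inner n (\<phi> i) (\<psi> j))"
    unfolding sphere_inner_def using assms
    by (simp add: Bochner_Integration.integral_sum sq_int_mult_integrable)
  finally show ?thesis .
qed

text \<open>Linearity of an operator on representatives holds only almost everywhere; this carries
  it into inner products.\<close>

lemma sphere_inner_cong_AE:
  assumes "sq_int n \<phi>" "sq_int n \<phi>'" "sq_int n \<psi>" "AE x in sphere_measure n. \<phi> x = \<phi>' x"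
  shows "sphere_inner n \<phi> \<psi> = sphere_inner n \<phi>' \<psi>"
  unfolding sphere_inner_def
proof (rule integral_cong_AE)
  have [measurable]: "\<phi> \<in> borel_measurable (sphere_measure n)" "\<psi> \<in> borel_measurable (sphere_measure n)"
    "\<phi>' \<in> borel_measurable (sphere_measure n)"
    using assms by (auto dest: sq_int_measurable)
  show "(\<lambda>x. \<phi> x * cnj (\<psi> x)) \<in> borel_measurable (sphere_measure n)"
    "(\<lambda>x. \<phi>' x * cnj (\<psi> x)) \<in> borel_measurable (sphere_measure n)"
    by measurable
qed (use assms(4) in auto)

definition sphere_mass :: "nat \<Rightarrow> real" where
  "sphere_mass n = measure (sphere_measure n) (space (sphere_measure n))"

lemma sq_int_bounded:
  assumes m: "\<phi> \<in> borel_measurable (sphere_measure n)"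
    and b: "AE x in sphere_measure n. cmod (\<phi> x) \<le> B" and B: "0 \<le> B"
  shows "sq_int n \<phi>" and "L2norm n \<phi> \<le> sqrt (sphere_mass n) * B"
proof -
  interpret finite_measure "sphere_measure n" by (rule finite_measure_sphere)
  note m [measurable]
  have b2: "AE x in sphere_measure n. (cmod (\<phi> x))\<^sup>2 \<le> B\<^sup>2"
    using b by eventually_elim (simp add: power_mono)
  have i: "integrable (sphere_measure n) (\<lambda>x. (cmod (\<phi> x))\<^sup>2)"
    by (rule Bochner_Integration.integrable_bound[OF integrable_const[of "B\<^sup>2"]]) (use b2 in auto)
  then show "sq_int n \<phi>" by (simp add: sq_int_def m)
  have "(\<integral>x. (cmod (\<phi> x))\<^sup>2 \<partial>sphere_measure n) \<le> (\<integral>x. B\<^sup>2 \<partial>sphere_measure n)"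
    by (rule integral_mono_AE[OF i _ b2]) simp
  also have "\<dots> = sphere_mass n * B\<^sup>2"
    by (simp add: sphere_mass_def)
  finally have "L2norm n \<phi> \<le> sqrt (sphere_mass n * B\<^sup>2)"
    by (simp add: L2norm_def)
  then show "L2norm n \<phi> \<le> sqrt (sphere_mass n) * B"
    using B by (simp add: real_sqrt_mult)
qed

section \<open>Bounded operators on representatives\<close>

lemma bounded_op_sq_int: "bounded_op n A \<Longrightarrow> sq_int n \<phi> \<Longrightarrow> sq_int n (A \<phi>)"
  by (simp add: bounded_op_def)

lemma bounded_op_lincomb:
  "bounded_op n A \<Longrightarrow> sq_int n \<phi> \<Longrightarrow> sq_int n \<psi> \<Longrightarrow>
    AE x in sphere_measure n. A (\<lambda>y. a * \<phi> y + b * \<psi> y) x = a * A \<phi> x + b * A \<psi> x"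
  by (simp add: bounded_op_def)

lemma bounded_op_bound:
  assumes "bounded_op n A"
  obtains C where "0 \<le> C" "\<And>\<phi>. sq_int n \<phi> \<Longrightarrow> L2norm n (A \<phi>) \<le> C * L2norm n \<phi>"
proof -
  obtain C where C: "\<And>\<phi>. sq_int n \<phi> \<Longrightarrow> L2norm n (A \<phi>) \<le> C * L2norm n \<phi>"
    using assms by (auto simp: bounded_op_def)
  show ?thesis
  \<comment> \<open>The bound in \<open>bounded_op\<close> may have any sign; a nonnegative one is
    required for multiplying estimates.\<close>
  proof (rule that[of "max C 0"])
    fix \<phi> assume "sq_int n \<phi>"
    from C[OF this] show "L2norm n (A \<phi>) \<le> max C 0 * L2norm n \<phi>"
      by (rule order_trans) (intro mult_right_mono L2norm_nonneg, simp)
  qed simp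
qed

lemma bounded_op_sum:
  assumes A: "bounded_op n A"
  shows "finite I \<Longrightarrow> (\<And>i. i \<in> I \<Longrightarrow> sq_int n (\<phi> i)) \<Longrightarrow>
    AE x in sphere_measure n. A (\<lambda>y. \<Sum>i\<in>I. c i * \<phi> i y) x = (\<Sum>i\<in>I. c i * A (\<phi> i) x)"
proof (induction I rule: finite_induct)
  case empty
  show ?case using bounded_op_lincomb[OF A sq_int_zero sq_int_zero, of 0 0] by simp
next
  case (insert i I)
  have "AE x in sphere_measure n. A (\<lambda>y. c i * \<phi> i y + 1 * (\<Sum>i\<in>I. c i * \<phi> i y)) x
      = c i * A (\<phi> i) x + 1 * A (\<lambda>y. \<Sum>i\<in>I. c i * \<phi> i y) x"
    using insert by (intro bounded_op_lincomb[OF A] sq_int_sum) auto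
  moreover have "AE x in sphere_measure n. A (\<lambda>y. \<Sum>i\<in>I. c i * \<phi> i y) x = (\<Sum>i\<in>I. c i * A (\<phi> i) x)"
    using insert by auto
  ultimately show ?case
    by eventually_elim (use insert in simp)
qed

section \<open>Truncation of the coherent states and uniform error bounds\<close>

definition coh_coeff :: "nat \<Rightarrow> real \<Rightarrow> nat \<Rightarrow> real" where
  "coh_coeff n hbar l = sqrt (2 * real l + real n - 1) / (fact l * sqrt (real n - 1)) / hbar ^ l"

definition coh_sum :: "nat \<Rightarrow> real \<Rightarrow> nat \<Rightarrow> cvec \<Rightarrow> rvec \<Rightarrow> complex" where
  "coh_sum n hbar N \<alpha> x =
     (\<Sum>l<N. complex_of_real (coh_coeff n hbar l) * (\<Sum>s<Suc n. complex_of_real (x s) * cnj (\<alpha> s)) ^ l)"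

lemma coh_eq:
  "coh n hbar \<alpha> x =
     (\<Sum>l. complex_of_real (coh_coeff n hbar l) * (\<Sum>s<Suc n. complex_of_real (x s) * cnj (\<alpha> s)) ^ l)"
  unfolding coh_def coh_coeff_def
  by (intro suminf_cong) (simp add: power_divide del: sum.lessThan_Suc)

lemma coh_coeff_nonneg: "2 \<le> n \<Longrightarrow> 0 < hbar \<Longrightarrow> 0 \<le> coh_coeff n hbar l"
  by (simp add: coh_coeff_def)

text \<open>Bernoulli's inequality absorbs the square root into \<open>real n * 3 ^ l\<close>, so
  the exponential series at \<open>3 * r / hbar\<close> dominates.\<close>

lemma summable_coh_coeff:
  assumes n: "2 \<le> n" and h: "0 < hbar" and r: "0 \<le> r"
  shows "summable (\<lambda>l. coh_coeff n hbar l * r ^ l)"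
proof (rule summable_comparison_test)
  have "coh_coeff n hbar l * r ^ l \<le> real n * ((3 * r / hbar) ^ l / fact l)" for l
  proof -
    have "sqrt (2 * real l + real n - 1) \<le> 2 * real l + real n - 1"
      using n by (intro real_le_lsqrt self_le_power) auto
    also have "\<dots> \<le> real n * (1 + real l * 2)"
    proof -
      have "2 * real l * 1 \<le> 2 * real l * real n"
        using n by (intro mult_left_mono) auto
      then show ?thesis by (simp add: algebra_simps)
    qed
    also have "\<dots> \<le> real n * 3 ^ l"
      using Bernoulli_inequality[of 2 l] by (intro mult_left_mono) auto
    finally have 1: "sqrt (2 * real l + real n - 1) \<le> real n * 3 ^ l" .
    have "sqrt (2 * real l + real n - 1) / (fact l * sqrt (real n - 1)) \<le> real n * 3 ^ l / (fact l * 1)"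
      using n by (intro frac_le[OF _ 1]) (auto intro!: mult_left_mono)
    then have "sqrt (2 * real l + real n - 1) / (fact l * sqrt (real n - 1)) / hbar ^ l * r ^ l
      \<le> real n * 3 ^ l / (fact l * 1) / hbar ^ l * r ^ l"
      using h r by (intro mult_right_mono divide_right_mono) auto
    then show ?thesis
      by (simp add: coh_coeff_def power_divide power_mult_distrib mult_ac)
  qed
  then show "\<exists>N. \<forall>l\<ge>N. norm (coh_coeff n hbar l * r ^ l) \<le> real n * ((3 * r / hbar) ^ l / fact l)"
    using coh_coeff_nonneg[OF n h] r by simp
  show "summable (\<lambda>l. real n * ((3 * r / hbar) ^ l / fact l))"
    using summable_exp[of "3 * r / hbar"] by (intro summable_mult) (simp add: divide_inverse mult.commute)
qed

lemma measurable_coordinate [measurable]: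
  "s < Suc n \<Longrightarrow> (\<lambda>x. x s) \<in> borel_measurable (sphere_measure n)"
proof -
  assume "s < Suc n"
  then have "(\<lambda>x. x s) \<in> lebR (Suc n) \<rightarrow>\<^sub>M lborel"
    unfolding lebR_def by (intro measurable_component_singleton) simp
  then show ?thesis
    by (simp add: sphere_measure_def)
qed

lemma measurable_coh [measurable]:
  "coh n hbar \<alpha> \<in> borel_measurable (sphere_measure n)"
  "coh_sum n hbar N \<alpha> \<in> borel_measurable (sphere_measure n)"
proof -
  have [measurable]: "(\<lambda>x. \<Sum>s<Suc n. complex_of_real (x s) * cnj (\<alpha> s)) \<in> borel_measurable (sphere_measure n)"
    by (intro borel_measurable_sum borel_measurable_times borel_measurable_const
        borel_measurable_of_real measurable_coordinate) auto
  show "coh n hbar \<alpha> \<in> borel_measurable (sphere_measure n)"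
    unfolding coh_eq[abs_def] by measurable
  show "coh_sum n hbar N \<alpha> \<in> borel_measurable (sphere_measure n)"
    unfolding coh_sum_def[abs_def] by measurable
qed

context
  fixes n :: nat and hbar r :: real
  assumes n: "2 \<le> n" and h: "0 < hbar" and r: "0 \<le> r"
begin

text \<open>An error bound for truncation at \<open>N\<close>, uniform over the unit ball and over
  all labels whose coordinate moduli sum to at most \<open>r\<close>. At \<open>N = 0\<close> it
  bounds the states themselves.\<close>

definition coh_tail :: "nat \<Rightarrow> real" where
  "coh_tail N = (\<Sum>l. coh_coeff n hbar (l + N) * r ^ (l + N))"

lemma coh_tail_nonneg: "0 \<le> coh_tail N"
  unfolding coh_tail_def
  using summable_ignore_initial_segment[OF summable_coh_coeff[OF n h r], of N] coh_coeff_nonneg[OF n h] r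
  by (intro suminf_nonneg) auto

lemma coh_tail_tendsto: "coh_tail \<longlonglongrightarrow> 0"
  unfolding coh_tail_def
  by (rule suminf_exist_split2[OF summable_coh_coeff[OF n h r]])

lemma coh_diff_bound:
  assumes "(\<Sum>s<Suc n. cmod (\<alpha> s)) \<le> r" and x: "(\<Sum>s<Suc n. (x s)\<^sup>2) \<le> 1"
  shows "cmod (coh n hbar \<alpha> x - coh_sum n hbar N \<alpha> x) \<le> coh_tail N"
    and "cmod (coh_sum n hbar N \<alpha> x) \<le> coh_tail 0"
proof -
  define y where "y = (\<Sum>s<Suc n. complex_of_real (x s) * cnj (\<alpha> s))"
  have x1: "\<bar>x s\<bar> \<le> 1" if "s < Suc n" for s
  proof -
    have "(x s)\<^sup>2 \<le> (\<Sum>s<Suc n. (x s)\<^sup>2)"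
      using that by (intro member_le_sum) auto
    with x have "(x s)\<^sup>2 \<le> 1" by simp
    then show ?thesis by (simp add: abs_square_le_1)
  qed
  have "cmod y \<le> (\<Sum>s<Suc n. cmod (complex_of_real (x s) * cnj (\<alpha> s)))"
    unfolding y_def by (rule norm_sum)
  also have "\<dots> \<le> (\<Sum>s<Suc n. cmod (\<alpha> s))"
    using x1 by (intro sum_mono) (auto simp: norm_mult intro!: mult_left_le_one_le)
  finally have y: "cmod y \<le> r" using assms(1) by simp
  let ?f = "\<lambda>l. complex_of_real (coh_coeff n hbar l) * y ^ l"
  have b: "norm (?f l) \<le> coh_coeff n hbar l * r ^ l" for l
    using y coh_coeff_nonneg[OF n h, of l]
    by (auto simp: norm_mult norm_power intro!: mult_left_mono power_mono)
  have sm: "summable ?f"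
    by (rule summable_comparison_test[OF _ summable_coh_coeff[OF n h r]]) (use b in auto)
  have "coh n hbar \<alpha> x - coh_sum n hbar N \<alpha> x = (\<Sum>l. ?f (l + N))"
    using suminf_split_initial_segment[OF sm, of N] by (simp add: coh_eq coh_sum_def y_def)
  then show "cmod (coh n hbar \<alpha> x - coh_sum n hbar N \<alpha> x) \<le> coh_tail N"
    unfolding coh_tail_def using b
    by (auto intro!: norm_suminf_le summable_ignore_initial_segment[OF summable_coh_coeff[OF n h r]])
  have "cmod (coh_sum n hbar N \<alpha> x) \<le> (\<Sum>l<N. coh_coeff n hbar l * r ^ l)"
    unfolding coh_sum_def y_def[symmetric] by (rule sum_norm_le) (rule b)
  also have "\<dots> \<le> coh_tail 0"
    unfolding coh_tail_def add_0_right using coh_coeff_nonneg[OF n h] r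
    by (intro sum_le_suminf[OF summable_coh_coeff[OF n h r]]) auto
  finally show "cmod (coh_sum n hbar N \<alpha> x) \<le> coh_tail 0" .
qed

lemma coh_L2:
  assumes "(\<Sum>s<Suc n. cmod (\<alpha> s)) \<le> r"
  shows "sq_int n (coh n hbar \<alpha>)" "L2norm n (coh n hbar \<alpha>) \<le> sqrt (sphere_mass n) * coh_tail 0"
    "sq_int n (coh_sum n hbar N \<alpha>)" "L2norm n (coh_sum n hbar N \<alpha>) \<le> sqrt (sphere_mass n) * coh_tail 0"
    "L2norm n (\<lambda>x. coh n hbar \<alpha> x - coh_sum n hbar N \<alpha> x) \<le> sqrt (sphere_mass n) * coh_tail N"
proof -
  \<comment> \<open>The truncation of length 0 vanishes, so the difference estimate at
    \<open>N = 0\<close> bounds the whole state.\<close>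
  have "AE x in sphere_measure n. cmod (coh n hbar \<alpha> x) \<le> coh_tail 0"
    using AE_sphere by eventually_elim (use coh_diff_bound(1)[OF assms, of _ 0] in \<open>simp add: coh_sum_def\<close>)
  then show "sq_int n (coh n hbar \<alpha>)" "L2norm n (coh n hbar \<alpha>) \<le> sqrt (sphere_mass n) * coh_tail 0"
    by (auto intro!: sq_int_bounded coh_tail_nonneg)
  have "AE x in sphere_measure n. cmod (coh_sum n hbar N \<alpha> x) \<le> coh_tail 0"
    using AE_sphere by eventually_elim (rule coh_diff_bound(2)[OF assms])
  then show "sq_int n (coh_sum n hbar N \<alpha>)" "L2norm n (coh_sum n hbar N \<alpha>) \<le> sqrt (sphere_mass n) * coh_tail 0"
    by (auto intro!: sq_int_bounded coh_tail_nonneg)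
  have "AE x in sphere_measure n. cmod (coh n hbar \<alpha> x - coh_sum n hbar N \<alpha> x) \<le> coh_tail N"
    using AE_sphere by eventually_elim (rule coh_diff_bound(1)[OF assms])
  then show "L2norm n (\<lambda>x. coh n hbar \<alpha> x - coh_sum n hbar N \<alpha> x) \<le> sqrt (sphere_mass n) * coh_tail N"
    by (intro sq_int_bounded(2) coh_tail_nonneg) measurable
qed

text \<open>One argument is replaced at a time, and Cauchy-Schwarz bounds each of the two errors;
  hence the factor 2. The bound sees the labels only through \<open>r\<close>, which gives
  uniformity on compact sets.\<close>

lemma form_approx:
  assumes A: "bounded_op n A" and C: "0 \<le> C" "\<And>\<phi>. sq_int n \<phi> \<Longrightarrow> L2norm n (A \<phi>) \<le> C * L2norm n \<phi>"
    and a: "(\<Sum>s<Suc n. cmod (\<alpha> s)) \<le> r" and b: "(\<Sum>s<Suc n. cmod (\<beta> s)) \<le> r"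
  shows "cmod (sphere_inner n (A (coh n hbar \<alpha>)) (coh n hbar \<beta>)
      - sphere_inner n (A (coh_sum n hbar N \<alpha>)) (coh_sum n hbar N \<beta>))
    \<le> 2 * C * sphere_mass n * coh_tail 0 * coh_tail N"
proof -
  let ?c = "sqrt (sphere_mass n)" and ?\<phi> = "coh n hbar \<alpha>" and ?\<psi> = "coh n hbar \<beta>"
    and ?p = "coh_sum n hbar N \<alpha>" and ?q = "coh_sum n hbar N \<beta>"
  have mass: "0 \<le> sphere_mass n" by (simp add: sphere_mass_def)
  note \<phi> = coh_L2[OF a] and \<psi> = coh_L2[OF b]
  have sq: "sq_int n (A ?\<phi>)" "sq_int n (A ?p)" "sq_int n (\<lambda>x. ?\<phi> x - ?p x)"
    "sq_int n (A (\<lambda>x. ?\<phi> x - ?p x))" "sq_int n (\<lambda>x. ?\<psi> x - ?q x)"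
    using bounded_op_sq_int[OF A \<phi>(1)] bounded_op_sq_int[OF A \<phi>(3)] sq_int_diff[OF \<phi>(1,3)]
      bounded_op_sq_int[OF A sq_int_diff[OF \<phi>(1,3)]] sq_int_diff[OF \<psi>(1,3)] by simp_all
  have "AE x in sphere_measure n. A (\<lambda>x. ?\<phi> x - ?p x) x = A ?\<phi> x - A ?p x"
    using bounded_op_lincomb[OF A \<phi>(1,3), of 1 "-1"] by simp
  then have "sphere_inner n (A ?\<phi>) ?\<psi> - sphere_inner n (A ?p) ?\<psi> = sphere_inner n (A (\<lambda>x. ?\<phi> x - ?p x)) ?\<psi>"
    using sphere_inner_cong_AE[OF sq(4) sq_int_diff[OF sq(1,2)] \<psi>(1)]
      sphere_inner_diff_left[OF sq(1,2) \<psi>(1)] by simp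
  then have eq: "sphere_inner n (A ?\<phi>) ?\<psi> - sphere_inner n (A ?p) ?q
      = sphere_inner n (A (\<lambda>x. ?\<phi> x - ?p x)) ?\<psi> + sphere_inner n (A ?p) (\<lambda>x. ?\<psi> x - ?q x)"
    using sphere_inner_diff_right[OF \<psi>(1,3) sq(2), of N] by (simp add: algebra_simps)
  have 1: "cmod (sphere_inner n (A (\<lambda>x. ?\<phi> x - ?p x)) ?\<psi>) \<le> (C * (?c * coh_tail N)) * (?c * coh_tail 0)"
  proof (rule order_trans[OF sphere_inner_Cauchy_Schwarz[OF sq(4) \<psi>(1)]], rule mult_mono)
    show "L2norm n (A (\<lambda>x. ?\<phi> x - ?p x)) \<le> C * (?c * coh_tail N)"
      by (rule order_trans[OF C(2)[OF sq(3)]]) (intro mult_left_mono \<phi>(5) C(1))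
  qed (use \<psi> mass C in \<open>auto intro!: mult_nonneg_nonneg coh_tail_nonneg L2norm_nonneg\<close>)
  have 2: "cmod (sphere_inner n (A ?p) (\<lambda>x. ?\<psi> x - ?q x)) \<le> (C * (?c * coh_tail 0)) * (?c * coh_tail N)"
  proof (rule order_trans[OF sphere_inner_Cauchy_Schwarz[OF sq(2,5)]], rule mult_mono)
    show "L2norm n (A ?p) \<le> C * (?c * coh_tail 0)"
      by (rule order_trans[OF C(2)[OF \<phi>(3)]]) (intro mult_left_mono \<phi>(4) C(1))
  qed (use \<psi> mass C in \<open>auto intro!: mult_nonneg_nonneg coh_tail_nonneg L2norm_nonneg\<close>)
  have "(C * (c * t)) * (c * u) + (C * (c * u)) * (c * t) = 2 * C * (c * c) * u * t" for c t u
    by (simp add: mult_ac)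
  then have "(C * (?c * coh_tail N)) * (?c * coh_tail 0) + (C * (?c * coh_tail 0)) * (?c * coh_tail N)
      = 2 * C * (?c * ?c) * coh_tail 0 * coh_tail N" .
  also have "?c * ?c = sphere_mass n" using mass by simp
  finally have "(C * (?c * coh_tail N)) * (?c * coh_tail 0) + (C * (?c * coh_tail 0)) * (?c * coh_tail N)
      = 2 * C * sphere_mass n * coh_tail 0 * coh_tail N" .
  with 1 2 show ?thesis
    unfolding eq by (intro order_trans[OF norm_triangle_ineq]) linarith
qed

end

section \<open>The truncated form as a polynomial, and holomorphy of its limit\<close>

text \<open>An index is a length together with a word of coordinate indices. Expanding powers over
  words, without collecting equal monomials, avoids multinomial coefficients.\<close>

definition monomial :: "nat \<times> (nat \<Rightarrow> nat) \<Rightarrow> rvec \<Rightarrow> complex" where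
  "monomial p x = (\<Prod>i<fst p. complex_of_real (x (snd p i)))"

definition monomial_coeff :: "nat \<Rightarrow> real \<Rightarrow> cvec \<Rightarrow> nat \<times> (nat \<Rightarrow> nat) \<Rightarrow> complex" where
  "monomial_coeff n hbar a p = complex_of_real (coh_coeff n hbar (fst p)) * (\<Prod>i<fst p. a (snd p i))"

definition monomials :: "nat \<Rightarrow> nat \<Rightarrow> (nat \<times> (nat \<Rightarrow> nat)) set" where
  "monomials n N = Sigma {..<N} (\<lambda>l. PiE {..<l} (\<lambda>_. {..<Suc n}))"

lemma finite_monomials: "finite (monomials n N)"
  unfolding monomials_def by (intro finite_SigmaI finite_PiE) simp_all

lemma monomials_index:
  assumes "p \<in> monomials n N" and "i < fst p"
  shows "snd p i < Suc n"
proof -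
  have "snd p \<in> PiE {..<fst p} (\<lambda>_. {..<Suc n})"
    using assms(1) by (cases p) (simp add: monomials_def)
  then have "snd p i \<in> {..<Suc n}"
    by (rule PiE_mem) (use assms(2) in simp)
  then show ?thesis by simp
qed

lemma coh_sum_monomials:
  "coh_sum n hbar N \<alpha> x
    = (\<Sum>p\<in>monomials n N. monomial_coeff n hbar (\<lambda>s. cnj (\<alpha> s)) p * monomial p x)"
proof -
  have pow: "(\<Sum>s<Suc n. complex_of_real (x s) * cnj (\<alpha> s)) ^ l
      = (\<Sum>g\<in>PiE {..<l} (\<lambda>_. {..<Suc n}). (\<Prod>i<l. cnj (\<alpha> (g i))) * monomial (l, g) x)" for l
  proof -
    have "(\<Sum>s<Suc n. complex_of_real (x s) * cnj (\<alpha> s)) ^ l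
      = (\<Prod>i<l. \<Sum>s\<in>{..<Suc n}. complex_of_real (x s) * cnj (\<alpha> s))"
      by simp
    also have "\<dots> = (\<Sum>g\<in>PiE {..<l} (\<lambda>_. {..<Suc n}). \<Prod>i<l. complex_of_real (x (g i)) * cnj (\<alpha> (g i)))"
      by (rule prod_sum_PiE) auto
    finally show ?thesis
      by (simp add: monomial_def prod.distrib mult.commute)
  qed
  have "coh_sum n hbar N \<alpha> x = (\<Sum>l<N. \<Sum>g\<in>PiE {..<l} (\<lambda>_. {..<Suc n}).
      monomial_coeff n hbar (\<lambda>s. cnj (\<alpha> s)) (l, g) * monomial (l, g) x)"
    unfolding coh_sum_def pow by (simp add: monomial_coeff_def sum_distrib_left mult.assoc)
  also have "\<dots> = (\<Sum>p\<in>monomials n N. monomial_coeff n hbar (\<lambda>s. cnj (\<alpha> s)) p * monomial p x)"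
  proof -
    let ?F = "\<lambda>p. monomial_coeff n hbar (\<lambda>s. cnj (\<alpha> s)) p * monomial p x"
    have "(\<Sum>l<N. \<Sum>g\<in>PiE {..<l} (\<lambda>_. {..<Suc n}). ?F (l, g))
      = (\<Sum>(l, g)\<in>Sigma {..<N} (\<lambda>l. PiE {..<l} (\<lambda>_. {..<Suc n})). ?F (l, g))"
      by (intro sum.Sigma ballI finite_PiE) simp_all
    also have "(\<lambda>(l, g). ?F (l, g)) = ?F" by (simp add: fun_eq_iff)
    finally show ?thesis unfolding monomials_def .
  qed
  finally show ?thesis .
qed

lemma sq_int_monomial:
  assumes "p \<in> monomials n N"
  shows "sq_int n (monomial p)"
proof (rule sq_int_bounded(1)[where B = 1])
  note idx = monomials_index[OF assms]
  show "monomial p \<in> borel_measurable (sphere_measure n)"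
    unfolding monomial_def[abs_def]
    using idx by (intro borel_measurable_prod borel_measurable_of_real measurable_coordinate) auto
  show "AE x in sphere_measure n. cmod (monomial p x) \<le> 1"
    using AE_sphere
  proof eventually_elim
    fix x :: rvec assume x: "(\<Sum>i<Suc n. (x i)\<^sup>2) \<le> 1"
    have "\<bar>x s\<bar> \<le> 1" if "s < Suc n" for s
    proof -
      have "(x s)\<^sup>2 \<le> (\<Sum>s<Suc n. (x s)\<^sup>2)"
        using that by (intro member_le_sum) auto
      with x have "(x s)\<^sup>2 \<le> 1" by simp
      then show ?thesis by (simp add: abs_square_le_1)
    qed
    then show "cmod (monomial p x) \<le> 1"
      unfolding monomial_def prod_norm[symmetric]
      using idx by (intro prod_le_1) auto
  qed
qed simp

text \<open>This exhibits the truncated form as a polynomial in \<open>cnj \<alpha>\<close> and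
  \<open>\<beta>\<close> with matrix elements of \<open>A\<close> as coefficients. The second label
  appears without conjugation because the inner product conjugates its second argument and
  \<open>coh_coeff\<close> is real.\<close>

lemma form_coh_sum:
  assumes A: "bounded_op n A"
  shows "sphere_inner n (A (coh_sum n hbar N \<alpha>)) (coh_sum n hbar N \<beta>)
    = (\<Sum>p\<in>monomials n N. \<Sum>q\<in>monomials n N. monomial_coeff n hbar (\<lambda>s. cnj (\<alpha> s)) p
        * monomial_coeff n hbar \<beta> q * sphere_inner n (A (monomial p)) (monomial q))"
proof -
  have coh: "coh_sum n hbar N \<gamma> = (\<lambda>x. \<Sum>p\<in>monomials n N. monomial_coeff n hbar (\<lambda>s. cnj (\<gamma> s)) p * monomial p x)"
    for \<gamma> by (rule ext) (rule coh_sum_monomials)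
  have sq: "sq_int n (coh_sum n hbar N \<gamma>)" for \<gamma>
    unfolding coh by (intro sq_int_sum finite_monomials sq_int_monomial)
  have sqA: "sq_int n (A (monomial p))" if "p \<in> monomials n N" for p
    using sq_int_monomial[OF that] by (rule bounded_op_sq_int[OF A])
  have "AE x in sphere_measure n. A (coh_sum n hbar N \<alpha>) x
      = (\<Sum>p\<in>monomials n N. monomial_coeff n hbar (\<lambda>s. cnj (\<alpha> s)) p * A (monomial p) x)"
    unfolding coh by (intro bounded_op_sum[OF A] finite_monomials sq_int_monomial)
  moreover have "sq_int n (\<lambda>x. \<Sum>p\<in>monomials n N. monomial_coeff n hbar (\<lambda>s. cnj (\<alpha> s)) p * A (monomial p) x)"
    by (intro sq_int_sum finite_monomials sqA)
  ultimately have "sphere_inner n (A (coh_sum n hbar N \<alpha>)) (coh_sum n hbar N \<beta>)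
      = sphere_inner n (\<lambda>x. \<Sum>p\<in>monomials n N. monomial_coeff n hbar (\<lambda>s. cnj (\<alpha> s)) p * A (monomial p) x)
          (coh_sum n hbar N \<beta>)"
    using sphere_inner_cong_AE[OF bounded_op_sq_int[OF A sq] _ sq] by blast
  also have "\<dots> = (\<Sum>p\<in>monomials n N. \<Sum>q\<in>monomials n N. monomial_coeff n hbar (\<lambda>s. cnj (\<alpha> s)) p
        * cnj (monomial_coeff n hbar (\<lambda>s. cnj (\<beta> s)) q) * sphere_inner n (A (monomial p)) (monomial q))"
    unfolding coh[of \<beta>] by (intro sphere_inner_sum sqA sq_int_monomial)
  finally show ?thesis
    by (simp add: monomial_coeff_def)
qed

text \<open>A locally uniform limit of holomorphic functions is holomorphic. On the closed unit disc
  around a point the labels are bounded by compactness, so one tail bound serves the whole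
  disc.\<close>

lemma holomorphic_form:
  assumes A: "bounded_op n A" and n: "2 \<le> n" and h: "0 < hbar"
    and \<alpha>: "\<And>s. s < Suc n \<Longrightarrow> (\<lambda>\<xi>. cnj (\<alpha> \<xi> s)) holomorphic_on UNIV"
    and \<beta>: "\<And>s. s < Suc n \<Longrightarrow> (\<lambda>\<xi>. \<beta> \<xi> s) holomorphic_on UNIV"
  shows "(\<lambda>\<xi>. sphere_inner n (A (coh n hbar (\<alpha> \<xi>))) (coh n hbar (\<beta> \<xi>))) holomorphic_on UNIV"
    (is "?F holomorphic_on UNIV")
proof (rule holomorphic_uniform_sequence)
  let ?S = "\<lambda>N \<xi>. sphere_inner n (A (coh_sum n hbar N (\<alpha> \<xi>))) (coh_sum n hbar N (\<beta> \<xi>))"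
  show "?S N holomorphic_on UNIV" for N
    unfolding form_coh_sum[OF A] monomial_coeff_def
    by (intro holomorphic_intros \<alpha> \<beta> monomials_index) auto
  fix \<xi> :: complex
  obtain C where C: "0 \<le> C" "\<And>\<phi>. sq_int n \<phi> \<Longrightarrow> L2norm n (A \<phi>) \<le> C * L2norm n \<phi>"
    using bounded_op_bound[OF A] by auto
  have "\<exists>r. \<forall>\<zeta>\<in>cball \<xi> 1. f \<zeta> \<le> r" if "continuous_on (cball \<xi> 1) f" for f :: "complex \<Rightarrow> real"
    using compact_continuous_image[OF that compact_cball] compact_imp_bounded
    by (metis bounded_iff abs_le_D1 image_eqI real_norm_def)
  note bnd = this
  have ca: "continuous_on (cball \<xi> 1) (\<lambda>\<zeta>. \<Sum>s<Suc n. cmod (cnj (\<alpha> \<zeta> s)))"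
    using \<alpha> by (intro continuous_on_sum continuous_on_norm)
      (auto intro: continuous_on_subset[OF holomorphic_on_imp_continuous_on])
  have cb: "continuous_on (cball \<xi> 1) (\<lambda>\<zeta>. \<Sum>s<Suc n. cmod (\<beta> \<zeta> s))"
    using \<beta> by (intro continuous_on_sum continuous_on_norm)
      (auto intro: continuous_on_subset[OF holomorphic_on_imp_continuous_on])
  obtain r1 where r1: "\<And>\<zeta>. \<zeta> \<in> cball \<xi> 1 \<Longrightarrow> (\<Sum>s<Suc n. cmod (cnj (\<alpha> \<zeta> s))) \<le> r1"
    using bnd[OF ca] by blast
  obtain r2 where r2: "\<And>\<zeta>. \<zeta> \<in> cball \<xi> 1 \<Longrightarrow> (\<Sum>s<Suc n. cmod (\<beta> \<zeta> s)) \<le> r2"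
    using bnd[OF cb] by blast
  define r where "r = max 0 (max r1 r2)"
  have r: "0 \<le> r" by (simp add: r_def)
  have ra: "(\<Sum>s<Suc n. cmod (\<alpha> \<zeta> s)) \<le> r" and rb: "(\<Sum>s<Suc n. cmod (\<beta> \<zeta> s)) \<le> r"
    if "\<zeta> \<in> cball \<xi> 1" for \<zeta>
    using r1[OF that] r2[OF that] by (simp_all add: r_def del: sum.lessThan_Suc)
  define K where "K = 2 * C * sphere_mass n * coh_tail n hbar r 0"
  have lim: "(\<lambda>N. K * coh_tail n hbar r N) \<longlonglongrightarrow> 0"
    using tendsto_mult_right_zero[OF coh_tail_tendsto[OF n h r], of K] .
  have "uniform_limit (cball \<xi> 1) ?S ?F sequentially"
  proof (rule uniform_limitI)
    fix e :: real assume "0 < e"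
    with lim have "\<forall>\<^sub>F N in sequentially. K * coh_tail n hbar r N < e"
      by (rule order_tendstoD)
    then show "\<forall>\<^sub>F N in sequentially. \<forall>\<zeta>\<in>cball \<xi> 1. dist (?S N \<zeta>) (?F \<zeta>) < e"
    proof eventually_elim
      case (elim N)
      show ?case
      proof
        fix \<zeta> assume "\<zeta> \<in> cball \<xi> 1"
        then have "cmod (?F \<zeta> - ?S N \<zeta>) \<le> K * coh_tail n hbar r N"
          unfolding K_def by (intro form_approx[OF n h r A C ra rb])
        with elim show "dist (?S N \<zeta>) (?F \<zeta>) < e"
          by (simp add: dist_norm norm_minus_commute)
      qed
    qed
  qed
  then show "\<exists>d>0. cball \<xi> d \<subseteq> UNIV \<and> uniform_limit (cball \<xi> d) ?S ?F sequentially"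
    by (intro exI[of _ 1]) simp
qed simp

section \<open>Analytic continuation from real parameters\<close>

text \<open>The identity theorem, with 0 as accumulation point of the real line.\<close>

lemma holomorphic_zero_on_reals:
  assumes "f holomorphic_on UNIV" and "\<And>x. f (complex_of_real x) = 0"
  shows "f z = 0"
proof (rule analytic_continuation[OF assms(1)])
  show "0 islimpt range complex_of_real"
    unfolding islimpt_approachable
  proof (intro allI impI)
    fix e :: real assume "0 < e"
    then show "\<exists>y\<in>range complex_of_real. y \<noteq> 0 \<and> dist y 0 < e"
      by (intro bexI[OF _ rangeI[of complex_of_real "e / 2"]]) (auto simp: dist_norm norm_divide)
  qed
qed (use assms(2) in auto)

lemma holomorphic_on_if_const:
  "(P \<Longrightarrow> f holomorphic_on S) \<Longrightarrow> (\<not> P \<Longrightarrow> g holomorphic_on S)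
    \<Longrightarrow> (\<lambda>\<xi>. if P then f \<xi> else g \<xi>) holomorphic_on S"
  by (cases P) auto

lemma holomorphic_rho:
  assumes "\<And>i. (\<lambda>\<xi>. c \<xi> i) holomorphic_on UNIV"
  shows "(\<lambda>\<xi>. rho n m (c \<xi>) s) holomorphic_on UNIV"
  unfolding rho_def Let_def if_distribR
  by (intro holomorphic_on_if_const holomorphic_intros assms) simp_all

lemma holomorphic_cnj_rho:
  assumes "\<And>i. (\<lambda>\<xi>. cnj (c \<xi> i)) holomorphic_on UNIV"
  shows "(\<lambda>\<xi>. cnj (rho n m (c \<xi>) s)) holomorphic_on UNIV"
  unfolding rho_def Let_def if_distribR if_distrib[of cnj] complex_cnj_add complex_cnj_diff
    complex_cnj_mult complex_cnj_minus complex_cnj_divide complex_cnj_power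
  by (intro holomorphic_on_if_const holomorphic_intros assms) simp_all

section \<open>Covariance of symbols and of the star product\<close>

lemma sq_int_coh:
  assumes "2 \<le> n" and "0 < hbar"
  shows "sq_int n (coh n hbar \<alpha>)"
  using coh_L2(1)[OF assms sum_nonneg order_refl] by simp

text \<open>Polarization: the form \<open>\<langle>A \<Phi>\<^sub>v, \<Phi>\<^sub>u\<rangle>\<close> along the complex line through \<open>z\<close> and \<open>w\<close>,
  with parameters \<open>u = x + \<i> y\<close> and \<open>v = cnj x + \<i> cnj y\<close>, is holomorphic in \<open>x\<close> and in \<open>y\<close>, is a
  diagonal value for real \<open>x\<close> and \<open>y\<close>, and is the value at \<open>(w, z)\<close> for \<open>x = 1/2\<close>, \<open>y = -\<i>/2\<close>.\<close>
lemma form_determined: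
  assumes n: "2 \<le> n" and h: "0 < hbar" and A: "bounded_op n A" and B: "bounded_op n B"
    and diag: "\<And>z. sphere_inner n (A (Phi n m hbar z)) (Phi n m hbar z)
                 = sphere_inner n (B (Phi n m hbar z)) (Phi n m hbar z)"
  shows "sphere_inner n (A (Phi n m hbar z)) (Phi n m hbar w)
       = sphere_inner n (B (Phi n m hbar z)) (Phi n m hbar w)"
proof -
  define c where "c = (\<lambda>s i. z i + s * (w i - z i))"
  define F where "F = (\<lambda>u v. sphere_inner n (A (Phi n m hbar (c v))) (Phi n m hbar (c u))
    - sphere_inner n (B (Phi n m hbar (c v))) (Phi n m hbar (c u)))"
  have hol: "(\<lambda>\<xi>. F (u \<xi>) (v \<xi>)) holomorphic_on UNIV"
    if u: "u holomorphic_on UNIV" and v: "(\<lambda>\<xi>. cnj (v \<xi>)) holomorphic_on UNIV" for u v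
  proof -
    have "(\<lambda>\<xi>. rho n m (c (u \<xi>)) s) holomorphic_on UNIV" for s
      unfolding c_def by (intro holomorphic_rho holomorphic_intros u)
    moreover have "(\<lambda>\<xi>. cnj (rho n m (c (v \<xi>)) s)) holomorphic_on UNIV" for s
      unfolding c_def
      by (intro holomorphic_cnj_rho)
        (simp only: complex_cnj_add complex_cnj_mult, intro holomorphic_intros v)
    ultimately show ?thesis
      unfolding F_def by (intro holomorphic_on_diff holomorphic_form A B n h)
  qed
  define K where "K = (\<lambda>x y. F (x + \<i> * y) (cnj x + \<i> * cnj y))"
  have Kx: "(\<lambda>x. K x y) holomorphic_on UNIV" for y
    unfolding K_def by (intro hol) (auto intro!: holomorphic_intros)
  have Ky: "(\<lambda>y. K x y) holomorphic_on UNIV" for x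
    unfolding K_def by (intro hol) (auto intro!: holomorphic_intros)
  have "K (complex_of_real x) (complex_of_real y) = 0" for x y
    using diag by (simp add: K_def F_def)
  then have "K x (complex_of_real y) = 0" for x y
    using holomorphic_zero_on_reals[OF Kx] by blast
  then have "K x y = 0" for x y
    using holomorphic_zero_on_reals[OF Ky] by blast
  from this[of "1/2" "-\<i>/2"] have "F 1 0 = 0"
    by (simp add: K_def)
  moreover have "c 0 = z" "c 1 = w"
    by (simp_all add: c_def)
  ultimately show ?thesis by (simp add: F_def)
qed

lemma sphere_inner_self:
  "sphere_inner n \<phi> \<phi> = complex_of_real ((L2norm n \<phi>)\<^sup>2)"
proof -
  have "sphere_inner n \<phi> \<phi> = (\<integral>x. complex_of_real ((cmod (\<phi> x))\<^sup>2) \<partial>sphere_measure n)"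
    unfolding sphere_inner_def by (simp only: complex_norm_square)
  also have "\<dots> = complex_of_real (\<integral>x. (cmod (\<phi> x))\<^sup>2 \<partial>sphere_measure n)"
    by (rule integral_complex_of_real)
  finally show ?thesis by (simp add: L2norm_def)
qed

text \<open>This makes the arbitrary choice of operator in \<open>ext_symbol\<close>
  harmless.\<close>

lemma berezin_ext_determined:
  assumes n: "2 \<le> n" and h: "0 < hbar" and A: "bounded_op n A" and B: "bounded_op n B"
    and eq: "berezin n m hbar A = berezin n m hbar B"
  shows "berezin_ext n m hbar A = berezin_ext n m hbar B"
proof -
  have "sphere_inner n (A (Phi n m hbar z)) (Phi n m hbar z)
      = sphere_inner n (B (Phi n m hbar z)) (Phi n m hbar z)" for z
  proof (cases "L2norm n (Phi n m hbar z) = 0")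
    \<comment> \<open>With a vanishing denominator the symbol carries no information, but
      Cauchy-Schwarz forces both numerators to vanish.\<close>
    case True
    have "sphere_inner n (D (Phi n m hbar z)) (Phi n m hbar z) = 0" if "bounded_op n D" for D
      using sphere_inner_Cauchy_Schwarz[OF bounded_op_sq_int[OF that sq_int_coh[OF n h]] sq_int_coh[OF n h], of "rho n m z" "rho n m z"] True
      by simp
    with A B show ?thesis by simp
  next
    case False
    with fun_cong[OF eq, of z] show ?thesis
      by (simp add: berezin_def sphere_inner_self)
  qed
  from form_determined[OF n h A B this] show ?thesis
    by (simp add: berezin_ext_def fun_eq_iff)
qed

section \<open>Rotations of the sphere and conjugation of operators\<close>

text \<open>The measurable right inverse is included so that integrals are invariant for every
  integrand, measurable or not.\<close>

definition measure_automorphism :: "'a measure \<Rightarrow> ('a \<Rightarrow> 'a) \<Rightarrow> bool" where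
  "measure_automorphism M T \<longleftrightarrow> T \<in> M \<rightarrow>\<^sub>M M \<and> distr M M T = M
     \<and> (\<exists>T'\<in>M \<rightarrow>\<^sub>M M. \<forall>x\<in>space M. T (T' x) = x)"

lemma integral_measure_automorphism:
  fixes f :: "'a \<Rightarrow> 'b::{banach, second_countable_topology}"
  shows "measure_automorphism M T \<Longrightarrow> integral\<^sup>L M (\<lambda>x. f (T x)) = integral\<^sup>L M f"
  by (simp add: measure_automorphism_def integral_invariant)

lemma sphere_measure_automorphism:
  fixes R :: "nat \<Rightarrow> nat \<Rightarrow> real"
  assumes n: "n \<in> {2, 3, 5}"
    and R: "\<And>i j. i < Suc n \<Longrightarrow> j < Suc n \<Longrightarrow> (\<Sum>l<Suc n. R l i * R l j) = (if i = j then 1 else 0)"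
  shows "measure_automorphism (sphere_measure n) (\<lambda>x. \<lambda>i\<in>{..<Suc n}. \<Sum>j<Suc n. R i j * x j)"
proof -
  have "scaled_unitary (Suc n) 1 (\<lambda>i j. complex_of_real (R i j))"
    unfolding scaled_unitary_def
  proof (intro allI impI)
    fix i j assume "i < Suc n" "j < Suc n"
    from R[OF this, THEN arg_cong, of complex_of_real]
    show "(\<Sum>l<Suc n. cnj (complex_of_real (R l i)) * complex_of_real (R l j)) = (if i = j then 1 else 0)"
      by (simp del: sum.lessThan_Suc)
  qed
  from cnormsq_scaled_unitary[OF this, of "\<lambda>i. complex_of_real (x i)" for x]
  have "(\<Sum>i<Suc n. (cmod (complex_of_real (\<Sum>j<Suc n. R i j * x j)))\<^sup>2) = (\<Sum>i<Suc n. (x i)\<^sup>2)" for x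
    by (simp add: cnormsq_def del: sum.lessThan_Suc)
  then have isom: "(\<Sum>i<Suc n. (\<Sum>j<Suc n. R i j * x j)\<^sup>2) = (\<Sum>i<Suc n. (x i)\<^sup>2)" for x
    by (simp only: norm_of_real power2_abs)
  \<comment> \<open>These types index the real coordinates of the ambient space of the
    sphere.\<close>
  from n consider "CARD(3) = Suc n" | "CARD(4) = Suc n" | "CARD(6) = Suc n" by auto
  then show ?thesis
    unfolding measure_automorphism_def
    by cases ((intro conjI sphere_measure_isometry[OF _ isom]; assumption)+)
qed

lemma Phi_Lact:
  assumes nm: "(n, m) \<in> {(2, 2), (3, 4), (5, 8)}" and g: "g \<in> Fgrp m"
  obtains T T' where "measure_automorphism (sphere_measure n) T"
    and "measure_automorphism (sphere_measure n) T'"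
    and "\<And>x. x \<in> space (sphere_measure n) \<Longrightarrow> T' (T x) = x"
    and "\<And>hbar z x. Phi n m hbar (Lact g z) x = Phi n m hbar z (T x)"
proof -
  let ?k = "Suc n"
  from nm have n: "n \<in> {2, 3, 5}" by auto
  obtain R where R: "real_orthogonal ?k R"
    and rho: "\<And>z i. i < ?k \<Longrightarrow> rho n m (Lact g z) i = (\<Sum>j<?k. R i j * rho n m z j)"
    using rho_Lact[OF nm g] by blast
  show ?thesis
  proof (rule real_orthogonalE[OF R])
    fix Q :: "nat \<Rightarrow> nat \<Rightarrow> real"
    assume Q: "\<And>i j. i < ?k \<Longrightarrow> j < ?k \<Longrightarrow> complex_of_real (Q i j) = R i j"
      and row: "\<And>i j. i < ?k \<Longrightarrow> j < ?k \<Longrightarrow> (\<Sum>l<?k. Q i l * Q j l) = (if i = j then 1 else 0)"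
      and col: "\<And>i j. i < ?k \<Longrightarrow> j < ?k \<Longrightarrow> (\<Sum>l<?k. Q l i * Q l j) = (if i = j then 1 else 0)"
    \<comment> \<open>The matrix acting on the labels moves to the point \<open>x\<close> as its
      transpose, because it is real; \<open>T'\<close> is the matrix itself. Row orthogonality makes
      \<open>T\<close> an isometry and gives \<open>T' (T x) = x\<close>, the latter only for points
      \<open>undefined\<close> beyond the index set.\<close>
    define T where "T = (\<lambda>x::rvec. \<lambda>i\<in>{..<?k}. \<Sum>j<?k. Q j i * x j)"
    define T' where "T' = (\<lambda>x::rvec. \<lambda>i\<in>{..<?k}. \<Sum>j<?k. Q i j * x j)"
    show ?thesis
    proof (rule that)
      show "measure_automorphism (sphere_measure n) T"
        unfolding T_def by (rule sphere_measure_automorphism[OF n row])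
      show "measure_automorphism (sphere_measure n) T'"
        unfolding T'_def by (rule sphere_measure_automorphism[OF n col])
      show "T' (T x) = x" if "x \<in> space (sphere_measure n)" for x
      proof
        fix i
        show "T' (T x) i = x i"
        proof (cases "i < ?k")
          case True
          then have "T' (T x) i = (\<Sum>j<?k. \<Sum>l<?k. x l * (Q i j * Q l j))"
            by (simp add: T_def T'_def sum_distrib_left mult_ac del: sum.lessThan_Suc)
          also have "\<dots> = (\<Sum>l<?k. x l * (\<Sum>j<?k. Q i j * Q l j))"
            unfolding sum_distrib_left by (rule sum.swap)
          also have "\<dots> = (\<Sum>l<?k. if i = l then x l else 0)"
            using True by (intro sum.cong refl) (simp add: row del: sum.lessThan_Suc)
          also have "\<dots> = x i"
            using True by (simp del: sum.lessThan_Suc)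
          finally show ?thesis .
        next
          case False
          with that show ?thesis
            by (auto simp: T'_def sphere_measure_def lebR_def space_PiM PiE_iff extensional_def)
        qed
      qed
      show "Phi n m hbar (Lact g z) x = Phi n m hbar z (T x)" for hbar z x
      proof -
        have "(\<Sum>s<?k. complex_of_real (x s) * cnj (rho n m (Lact g z) s))
          = (\<Sum>s<?k. \<Sum>j<?k. complex_of_real (Q s j * x s) * cnj (rho n m z j))"
          by (intro sum.cong refl)
            (simp add: rho Q[symmetric] sum_distrib_left mult_ac del: sum.lessThan_Suc)
        also have "\<dots> = (\<Sum>j<?k. complex_of_real (T x j) * cnj (rho n m z j))"
          by (subst sum.swap, intro sum.cong refl)
            (simp add: T_def sum_distrib_right del: sum.lessThan_Suc)
        finally show ?thesis by (simp only: coh_def)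
      qed
    qed
  qed
qed

lemma sq_int_automorphism:
  assumes T: "measure_automorphism (sphere_measure n) T" and "sq_int n \<phi>"
  shows "sq_int n (\<lambda>x. \<phi> (T x))" and "L2norm n (\<lambda>x. \<phi> (T x)) = L2norm n \<phi>"
proof -
  let ?M = "sphere_measure n"
  have T': "T \<in> ?M \<rightarrow>\<^sub>M ?M" "distr ?M ?M T = ?M"
    using T by (auto simp: measure_automorphism_def)
  have m [measurable]: "\<phi> \<in> borel_measurable ?M"
    using assms(2) by (rule sq_int_measurable)
  have "integrable ?M (\<lambda>x. (cmod (\<phi> (T x)))\<^sup>2)"
    using integrable_distr[OF T'(1), of "\<lambda>x. (cmod (\<phi> x))\<^sup>2"] T'(2) sq_int_integrable[OF assms(2)] by simp
  with measurable_compose[OF T'(1) m] show "sq_int n (\<lambda>x. \<phi> (T x))"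
    by (simp add: sq_int_def)
  show "L2norm n (\<lambda>x. \<phi> (T x)) = L2norm n \<phi>"
    unfolding L2norm_def by (subst integral_measure_automorphism[OF T, of "\<lambda>x. (cmod (\<phi> x))\<^sup>2"]) (rule refl)
qed

lemma bounded_op_conjugate:
  assumes T: "measure_automorphism (sphere_measure n) T"
    and T': "measure_automorphism (sphere_measure n) T'" and A: "bounded_op n A"
  shows "bounded_op n (\<lambda>\<phi> x. A (\<lambda>y. \<phi> (T y)) (T' x))"
  unfolding bounded_op_def
proof (intro conjI allI impI)
  note sqT = sq_int_automorphism[OF T]
  note sqT' = sq_int_automorphism[OF T']
  show "sq_int n (\<lambda>x. A (\<lambda>y. \<phi> (T y)) (T' x))" if "sq_int n \<phi>" for \<phi>
    by (rule sqT'(1)[OF bounded_op_sq_int[OF A sqT(1)[OF that]]])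
  show "AE x in sphere_measure n. A (\<lambda>y. a * \<phi> (T y) + b * \<psi> (T y)) (T' x)
      = a * A (\<lambda>y. \<phi> (T y)) (T' x) + b * A (\<lambda>y. \<psi> (T y)) (T' x)"
    if "sq_int n \<phi>" "sq_int n \<psi>" for \<phi> \<psi> a b
  proof -
    have *: "T' \<in> sphere_measure n \<rightarrow>\<^sub>M sphere_measure n" "distr (sphere_measure n) (sphere_measure n) T' = sphere_measure n"
      using T' by (auto simp: measure_automorphism_def)
    \<comment> \<open>The exceptional null set of \<open>A\<close> is pulled back along
      \<open>T'\<close> and stays null because \<open>T'\<close> preserves the measure.\<close>
    have "AE x in distr (sphere_measure n) (sphere_measure n) T'. A (\<lambda>y. a * \<phi> (T y) + b * \<psi> (T y)) x
      = a * A (\<lambda>y. \<phi> (T y)) x + b * A (\<lambda>y. \<psi> (T y)) x"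
      unfolding * by (rule bounded_op_lincomb[OF A sqT(1)[OF that(1)] sqT(1)[OF that(2)]])
    then show ?thesis by (rule AE_distrD[OF *(1)])
  qed
  obtain C where "\<And>\<phi>. sq_int n \<phi> \<Longrightarrow> L2norm n (A \<phi>) \<le> C * L2norm n \<phi>"
    using A by (auto simp: bounded_op_def)
  note C = this
  have "L2norm n (\<lambda>x. A (\<lambda>y. \<phi> (T y)) (T' x)) \<le> C * L2norm n \<phi>" if "sq_int n \<phi>" for \<phi>
    using C[OF sqT(1)[OF that]] sqT(2)[OF that] sqT'(2)[OF bounded_op_sq_int[OF A sqT(1)[OF that]]]
    by simp
  then show "\<exists>C. \<forall>\<phi>. sq_int n \<phi> \<longrightarrow> L2norm n (\<lambda>x. A (\<lambda>y. \<phi> (T y)) (T' x)) \<le> C * L2norm n \<phi>"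
    by blast
qed

lemma sphere_inner_Lact:
  assumes nm: "(n, m) \<in> {(2, 2), (3, 4), (5, 8)}" and g: "g \<in> Fgrp m"
  shows "sphere_inner n (Phi n m hbar (Lact g z)) (Phi n m hbar (Lact g w))
    = sphere_inner n (Phi n m hbar z) (Phi n m hbar w)"
proof -
  obtain T T' where T: "measure_automorphism (sphere_measure n) T"
    and Phi: "\<And>hbar z x. Phi n m hbar (Lact g z) x = Phi n m hbar z (T x)"
    using Phi_Lact[OF nm g] by metis
  show ?thesis
    unfolding sphere_inner_def Phi
    by (rule integral_measure_automorphism[OF T, of "\<lambda>x. Phi n m hbar z x * cnj (Phi n m hbar w x)"])
qed

text \<open>Rotating the integration variable by \<open>T\<close> cancels the \<open>T'\<close>
  applied to the output of \<open>A\<close> and turns the second state into the one at the moved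
  label.\<close>

lemma conjugate_Lact:
  assumes nm: "(n, m) \<in> {(2, 2), (3, 4), (5, 8)}" and g: "g \<in> Fgrp m" and A: "bounded_op n A"
  obtains B where "bounded_op n B"
    and "\<And>hbar w z. sphere_inner n (B (Phi n m hbar z)) (Phi n m hbar w)
      = sphere_inner n (A (Phi n m hbar (Lact g z))) (Phi n m hbar (Lact g w))"
proof -
  obtain T T' where T: "measure_automorphism (sphere_measure n) T"
    and T': "measure_automorphism (sphere_measure n) T'"
    and inv: "\<And>x. x \<in> space (sphere_measure n) \<Longrightarrow> T' (T x) = x"
    and Phi: "\<And>hbar z x. Phi n m hbar (Lact g z) x = Phi n m hbar z (T x)"
    using Phi_Lact[OF nm g] by metis
  define B where "B = (\<lambda>\<phi> x. A (\<lambda>y. \<phi> (T y)) (T' x))"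
  show ?thesis
  proof (rule that)
    show "bounded_op n B"
      unfolding B_def by (rule bounded_op_conjugate[OF T T' A])
    fix hbar w z
    have PhiL: "Phi n m hbar (Lact g z) = (\<lambda>x. Phi n m hbar z (T x))" for z
      by (rule ext) (rule Phi)
    have "sphere_inner n (B (Phi n m hbar z)) (Phi n m hbar w)
      = (\<integral>x. A (Phi n m hbar (Lact g z)) (T' (T x)) * cnj (Phi n m hbar w (T x)) \<partial>sphere_measure n)"
      unfolding sphere_inner_def B_def PhiL
      by (rule integral_measure_automorphism[OF T, symmetric])
    also have "\<dots> = sphere_inner n (A (Phi n m hbar (Lact g z))) (Phi n m hbar (Lact g w))"
      unfolding sphere_inner_def by (intro Bochner_Integration.integral_cong refl) (simp add: inv Phi)
    finally show "sphere_inner n (B (Phi n m hbar z)) (Phi n m hbar w)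
      = sphere_inner n (A (Phi n m hbar (Lact g z))) (Phi n m hbar (Lact g w))" .
  qed
qed

lemma ext_symbol_Lact:
  assumes nm: "(n, m) \<in> {(2, 2), (3, 4), (5, 8)}" and h: "0 < hbar" and g: "g \<in> Fgrp m"
    and f: "f \<in> Aset n m hbar"
  shows "f \<circ> Lact g \<in> Aset n m hbar"
    and "ext_symbol n m hbar (f \<circ> Lact g) w z = ext_symbol n m hbar f (Lact g w) (Lact g z)"
proof -
  have n: "2 \<le> n" using nm by auto
  define op where "op = (\<lambda>f. SOME A. bounded_op n A \<and> berezin n m hbar A = f)"
  have op: "bounded_op n (op f)" "berezin n m hbar (op f) = f" if "f \<in> Aset n m hbar" for f
  proof -
    from that have "\<exists>A. bounded_op n A \<and> berezin n m hbar A = f" by (auto simp: Aset_def)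
    from someI_ex[OF this] show "bounded_op n (op f)" "berezin n m hbar (op f) = f"
      by (simp_all add: op_def)
  qed
  obtain B where B: "bounded_op n B"
    and form: "\<And>hbar w z. sphere_inner n (B (Phi n m hbar z)) (Phi n m hbar w)
      = sphere_inner n (op f (Phi n m hbar (Lact g z))) (Phi n m hbar (Lact g w))"
    using conjugate_Lact[OF nm g op(1)[OF f]] by metis
  have ext: "berezin_ext n m hbar B w z = berezin_ext n m hbar (op f) (Lact g w) (Lact g z)" for w z
    by (simp add: berezin_ext_def form sphere_inner_Lact[OF nm g])
  have "berezin n m hbar B z = f (Lact g z)" for z
  proof -
    have "berezin n m hbar B z = berezin n m hbar (op f) (Lact g z)"
      by (simp add: berezin_def form sphere_inner_Lact[OF nm g])
    then show ?thesis by (simp add: op(2)[OF f])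
  qed
  then have bB: "berezin n m hbar B = f \<circ> Lact g" by (simp add: fun_eq_iff)
  show fL: "f \<circ> Lact g \<in> Aset n m hbar"
    unfolding Aset_def bB[symmetric] using B by blast
  \<comment> \<open>The chosen operator and the conjugate \<open>B\<close> may differ, but their
    diagonal symbols agree, hence so do the extended ones.\<close>
  have "berezin_ext n m hbar (op (f \<circ> Lact g)) = berezin_ext n m hbar B"
    using op[OF fL] B bB by (intro berezin_ext_determined n h) auto
  then show "ext_symbol n m hbar (f \<circ> Lact g) w z = ext_symbol n m hbar f (Lact g w) (Lact g z)"
    using ext by (simp add: ext_symbol_def op_def)
qed

text \<open>The hypothesis on \<open>f\<close> bridges \<open>Lact g u\<close>, which is 0 beyond
  coordinate \<open>m\<close>, and the map of the product space to itself, which is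
  \<open>undefined\<close> there.\<close>

lemma integral_mu_Lact:
  assumes m: "m \<in> {2, 4, 8}" and g: "g \<in> Fgrp m"
    and f: "\<And>u v. (\<And>i. i < m \<Longrightarrow> u i = v i) \<Longrightarrow> f u = f v"
  shows "integral\<^sup>L (mu m hbar) (\<lambda>u. f (Lact g u) :: complex) = integral\<^sup>L (mu m hbar) f"
proof -
  obtain U where U: "scaled_unitary m 1 U" and L: "\<And>z i. i < m \<Longrightarrow> Lact g z i = (\<Sum>j<m. U i j * z j)"
    using Lact_unitary[OF g] by blast
  have "f (Lact g u) = f (\<lambda>i\<in>{..<m}. \<Sum>j<m. U i j * u j)" for u
    by (rule f) (simp add: L)
  moreover have "integral\<^sup>L (mu m hbar) (\<lambda>u. f (\<lambda>i\<in>{..<m}. \<Sum>j<m. U i j * u j)) = integral\<^sup>L (mu m hbar) f"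
  proof -
    \<comment> \<open>The numbers 4, 8 and 16 are the real dimensions of the three complex
      spaces.\<close>
    from m consider "CARD(4) = 2 * m" | "CARD(8) = 2 * m" | "CARD(16) = 2 * m" by auto
    then show ?thesis
      by cases (rule mu_isometry[OF _ cnormsq_scaled_unitary[OF U]], assumption)+
  qed
  ultimately show ?thesis by simp
qed

theorem theorem5p2:
  fixes n m :: nat and hbar :: real and g :: felt and f1 f2 :: "cvec \<Rightarrow> complex"
  assumes "(n, m) \<in> {(2, 2), (3, 4), (5, 8)}"
    and "hbar > 0"
    and "g \<in> Fgrp m"
    and "f1 \<in> Aset n m hbar" and "f2 \<in> Aset n m hbar"
  shows "f1 \<circ> Lact g \<in> Aset n m hbar \<and> f2 \<circ> Lact g \<in> Aset n m hbar
    \<and> star n m hbar (f1 \<circ> Lact g) (f2 \<circ> Lact g) = star n m hbar f1 f2 \<circ> Lact g"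
proof (intro conjI ext)
  note ext = ext_symbol_Lact[OF assms(1-3)]
  show "f1 \<circ> Lact g \<in> Aset n m hbar" "f2 \<circ> Lact g \<in> Aset n m hbar"
    using ext(1) assms(4,5) by blast+
  have m: "m \<in> {2, 4, 8}" using assms(1) by auto
  fix z
  let ?w = "Lact g z"
  \<comment> \<open>The integrand of the right-hand side at the moved point; the integrand of the
    left-hand side will be \<open>H (Lact g u)\<close>, as the kernel is invariant and the symbols
    move in both arguments.\<close>
  define H where "H = (\<lambda>u. ext_symbol n m hbar f1 ?w u * ext_symbol n m hbar f2 u ?w
    * complex_of_real ((cmod (Qker n m hbar u ?w))\<^sup>2) / Qker n m hbar ?w ?w)"
  have H: "H u = H v" if "\<And>i. i < m \<Longrightarrow> u i = v i" for u v
    using rho_cong[OF that assms(1)]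
    by (simp add: H_def ext_symbol_def berezin_ext_def Qker_def)
  have "star n m hbar (f1 \<circ> Lact g) (f2 \<circ> Lact g) z = integral\<^sup>L (mu m hbar) (\<lambda>u. H (Lact g u))"
    unfolding star_def H_def ext(2)[OF assms(4)] ext(2)[OF assms(5)]
    by (simp add: Qker_def sphere_inner_Lact[OF assms(1,3)])
  also have "\<dots> = integral\<^sup>L (mu m hbar) H"
    by (rule integral_mu_Lact[OF m assms(3) H])
  also have "\<dots> = (star n m hbar f1 f2 \<circ> Lact g) z"
    by (simp add: star_def H_def)
  finally show "star n m hbar (f1 \<circ> Lact g) (f2 \<circ> Lact g) z = (star n m hbar f1 f2 \<circ> Lact g) z" .
qed

end
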